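(* Let $\epsilon>0$ be an arbitrary constant and let $(G,L)$ be an $\epsilon\Delta$-extra-color vertex-list-coloring instance such that $G$ is a tree with maximum degree $\Delta$ and $\frac{\ln^2(\Delta)}{\Delta}\leq\frac{\epsilon^2}{100}$. Let $(X,\pi_{n-1})$ be the associated weighted simplicial complex. Then for any $2\leq k\leq n$ and any face $\tau\in X$ of co-dimension $k$, $\lambda_2(P_\tau)\leq\frac{\frac1{20}+\frac1\epsilon}{k-1}$.
   Context: $G=(V,E)$ has $n=|V|$ vertices and degrees $\Delta_G(v)$. A vertex-list-coloring instance $(G,L)$ assigns to each $v$ a set $L(v)\subseteq[q]$; a proper $L$-vertex-list-coloring is $\sigma$ with $\sigma(v)\in L(v)$ and $\sigma(u)\neq\sigma(v)$ for adjacent $u,v$. It is $\beta$-extra-color if $|L(v)|\geq\beta+\Delta_G(v)$ for all $v$. Write $vc$ for $(v,c)$. $X=X(G,L)$ is the pure $(n-1)$-dimensional complex whose facets are $\{v\sigma(v):v\in V\}$ for proper $\sigma$ (faces are subsets of facets), $\pi_{n-1}$ uniform on facets, $\mathrm{codim}(\tau)=n-|\tau|$, $X_\tau(0)=\{x\notin\tau:\tau\cup\{x\}\in X\}$. For $\tau$ of co-dimension $k\geq2$, the local walk $P_\tau$ on $X_\tau(0)$ is $P_\tau(x,y)=\frac1{k-1}\Pr_{\sigma\sim\pi_{n-1}}[y\in\sigma\mid\sigma\supseteq\tau\cup\{x\}]$ for $x\neq y$, with zero diagonal; $\lambda_2(P_\tau)$ is its second largest eigenvalue. *)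

theory Defs
  imports
    "HOL-Probability.Probability"
    "Jordan_Normal_Form.Char_Poly"
    "Graph_Theory.Graph_Theory"
begin

text \<open>
  A finite simple undirected graph is a \<open>pair_graph\<close>: a finite, loop-free, symmetric
  relation, every edge being represented by its two opposite arcs. Hence the degree of
  a vertex is its out-degree. The predicate \<open>tree\<close> of the library \<open>Graph_Theory\<close> is about
  directed cycles and counts a pair of opposite arcs as a cycle; a cycle of an undirected
  graph has to have length at least 3.
\<close>

abbreviation vdegree :: "'v pair_pre_digraph \<Rightarrow> 'v \<Rightarrow> nat" where
  "vdegree G v \<equiv> out_degree (with_proj G) v"

definition max_vdegree :: "'v pair_pre_digraph \<Rightarrow> nat" where
  "max_vdegree G = Max (vdegree G ` pverts G)"

definition tree_graph :: "'v pair_pre_digraph \<Rightarrow> bool" where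
  "tree_graph G \<longleftrightarrow> pair_graph G \<and> Digraph_Component.connected (with_proj G) \<and>
     \<not> (\<exists>p. pre_digraph.cycle (with_proj G) p \<and> length p \<ge> 3)"

definition list_coloring_instance :: "nat \<Rightarrow> 'v pair_pre_digraph \<Rightarrow> ('v \<Rightarrow> nat set) \<Rightarrow> bool" where
  "list_coloring_instance q G L \<longleftrightarrow> pair_graph G \<and> (\<forall>v\<in>pverts G. L v \<subseteq> {1..q})"

definition extra_color :: "real \<Rightarrow> 'v pair_pre_digraph \<Rightarrow> ('v \<Rightarrow> nat set) \<Rightarrow> bool" where
  "extra_color \<beta> G L \<longleftrightarrow> (\<forall>v\<in>pverts G. real (card (L v)) \<ge> \<beta> + real (vdegree G v))"

definition proper_coloring ::
    "'v pair_pre_digraph \<Rightarrow> ('v \<Rightarrow> nat set) \<Rightarrow> ('v \<Rightarrow> nat) \<Rightarrow> bool" where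
  "proper_coloring G L \<sigma> \<longleftrightarrow>
     (\<forall>v\<in>pverts G. \<sigma> v \<in> L v) \<and> (\<forall>(u, v)\<in>parcs G. \<sigma> u \<noteq> \<sigma> v)"

definition facets :: "'v pair_pre_digraph \<Rightarrow> ('v \<Rightarrow> nat set) \<Rightarrow> ('v \<times> nat) set set" where
  "facets G L = {(\<lambda>v. (v, \<sigma> v)) ` pverts G | \<sigma>. proper_coloring G L \<sigma>}"

definition coloring_complex :: "'v pair_pre_digraph \<Rightarrow> ('v \<Rightarrow> nat set) \<Rightarrow> ('v \<times> nat) set set" where
  "coloring_complex G L = {\<tau>. \<exists>F\<in>facets G L. \<tau> \<subseteq> F}"

definition facet_distr :: "'v pair_pre_digraph \<Rightarrow> ('v \<Rightarrow> nat set) \<Rightarrow> ('v \<times> nat) set pmf" where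
  "facet_distr G L = pmf_of_set (facets G L)"

definition codim :: "'v pair_pre_digraph \<Rightarrow> ('v \<times> nat) set \<Rightarrow> nat" where
  "codim G \<tau> = card (pverts G) - card \<tau>"

definition link_points :: "'x set set \<Rightarrow> 'x set \<Rightarrow> 'x set" where
  "link_points X \<tau> = {x. x \<notin> \<tau> \<and> \<tau> \<union> {x} \<in> X}"

definition local_walk ::
    "'v pair_pre_digraph \<Rightarrow> ('v \<Rightarrow> nat set) \<Rightarrow> ('v \<times> nat) set \<Rightarrow> 'v \<times> nat \<Rightarrow> 'v \<times> nat \<Rightarrow> real" where
  "local_walk G L \<tau> x y =
     (if x = y then 0
      else 1 / (real (codim G \<tau>) - 1) *
        \<P>(\<sigma> in measure_pmf (facet_distr G L). y \<in> \<sigma> \<bar> \<tau> \<union> {x} \<subseteq> \<sigma>))"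

definition kernel_mat :: "'x list \<Rightarrow> ('x \<Rightarrow> 'x \<Rightarrow> real) \<Rightarrow> real mat" where
  "kernel_mat xs P = mat (length xs) (length xs) (\<lambda>(i, j). P (xs ! i) (xs ! j))"

text \<open>The enumeration of the index set is immaterial for the spectrum:\<close>

lemma char_poly_kernel_mat_cong:
  assumes "distinct xs" "distinct ys" "set xs = set ys"
  shows "char_poly (kernel_mat xs P) = char_poly (kernel_mat ys P)"
proof -
  define n where "n = length xs"
  have len: "length ys = n"
    unfolding n_def using assms by (metis distinct_card)
  have "\<forall>i<n. \<exists>j<n. ys ! j = xs ! i"
    using assms len by (metis in_set_conv_nth n_def)
  then obtain f where f: "\<And>i. i < n \<Longrightarrow> f i < n \<and> ys ! f i = xs ! i" by metis
  have inj: "f i = f j \<longleftrightarrow> i = j" if "i < n" "j < n" for i j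
    using f that assms(1) by (metis n_def nth_eq_iff_index_eq)
  define Q where "Q = mat n n (\<lambda>(i, j). if j = f i then 1 else (0::real))"
  define R where "R = mat n n (\<lambda>(i, j). if i = f j then 1 else (0::real))"
  have Q: "Q \<in> carrier_mat n n" and R: "R \<in> carrier_mat n n"
    by (auto simp: Q_def R_def)
  have A: "kernel_mat xs P \<in> carrier_mat n n" and B: "kernel_mat ys P \<in> carrier_mat n n"
    by (auto simp: kernel_mat_def n_def len)
  have delta: "(\<Sum>k = 0..<n. (if k = m then 1 else 0) * g k) = g m"
    "(\<Sum>k = 0..<n. g k * (if k = m then 1 else 0)) = g m" if "m < n" for m and g :: "nat \<Rightarrow> real"
    using that by (simp_all add: if_distrib[of "\<lambda>x. x * _"] if_distrib[of "\<lambda>x. _ * x"] sum.delta cong: if_cong)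
  have QR: "Q * R = 1\<^sub>m n"
    by (rule eq_matI) (simp_all add: Q_def R_def scalar_prod_def delta f inj)
  have RQ: "R * Q = 1\<^sub>m n"
    by (rule mat_mult_left_right_inverse[OF Q R QR])
  have QB: "Q * kernel_mat ys P = mat n n (\<lambda>(i, j). P (ys ! f i) (ys ! j))"
    by (rule eq_matI) (simp_all add: Q_def kernel_mat_def scalar_prod_def delta f len)
  have "kernel_mat xs P = Q * kernel_mat ys P * R"
    unfolding QB
    by (rule eq_matI)
       (simp_all add: R_def kernel_mat_def n_def[symmetric] scalar_prod_def delta f)
  then have "similar_mat_wit (kernel_mat xs P) (kernel_mat ys P) Q R"
    using A B Q R QR RQ unfolding similar_mat_wit_def Let_def by simp
  then show ?thesis
    unfolding similar_mat_def by (intro char_poly_similar) (auto simp: similar_mat_def)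
qed

text \<open>
  The second entry of the decreasingly sorted list of the real eigenvalues, repeated
  according to their algebraic multiplicity. A local walk \<open>P\<^sub>\<tau>\<close> is reversible, so all its
  \<open>|X\<^sub>\<tau>(0)|\<close> eigenvalues are real, and there are at least two of them if \<open>\<tau>\<close> is a face
  of co-dimension at least 2.
\<close>

definition second_eigenvalue :: "'x set \<Rightarrow> ('x \<Rightarrow> 'x \<Rightarrow> real) \<Rightarrow> real" where
  "second_eigenvalue S P =
     (let xs = (SOME xs. set xs = S \<and> distinct xs)
      in rev (sorted_list_of_multiset (proots (char_poly (kernel_mat xs P)))) ! 1)"

end

theory Submission
  imports Defs
begin

text \<open>
  Fix a face and let \<open>\<sigma>\<close> be uniform on the proper colourings that extend it. Up to the factor
  \<open>1 / (k - 1)\<close>, the quadratic form of the local walk at \<open>f\<close> is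
  \<open>E[(\<Sum>\<^sub>v f\<^sub>v(\<sigma>\<^sub>v))\<^sup>2] - E[\<Sum>\<^sub>v f\<^sub>v(\<sigma>\<^sub>v)\<^sup>2]\<close>, so the claim is an upper bound for the
  variance of a sum of functions of single colours by the sum of their variances.

  Deleting an edge \<open>uv\<close> of the tree makes the colours of \<open>u\<close> and \<open>v\<close> independent, and by
  recolouring each of them takes any given value with probability at most
  \<open>1 / (\<epsilon>\<Delta> + 1)\<close>; conditioning on them being different then gives the maximal correlation
  \<open>\<rho> \<le> 1 / (\<epsilon>\<Delta>)\<close>. Root the tree at a leaf and eliminate the vertices from the bottom: the
  variance is at most \<open>\<Sum>\<^sub>v s\<^sub>v\<^sup>2\<close> where \<open>s\<^sub>v \<le> \<parallel>f\<^sub>v\<parallel> + \<rho> \<Sum> s\<^sub>w\<close>, summed over the at most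
  \<open>\<Delta> - 1\<close> children \<open>w\<close> of \<open>v\<close>. The matrix of the child relation has norm at most
  \<open>\<surd>(\<Delta> - 1)\<close>, so the variance grows by a factor of at most \<open>(1 - \<rho> \<surd>(\<Delta> - 1))\<^sup>-\<^sup>2\<close>, which the
  assumption on \<open>\<Delta>\<close> bounds by \<open>1 + 1/20 + 1/\<epsilon>\<close>. A single edge (\<open>\<Delta> = 1\<close>) is treated
  directly.
\<close>

section \<open>Rooting a tree\<close>

text \<open>The strictly decreasing \<open>depth\<close> encodes well-foundedness of the parent map.
  Relativising to a set \<open>A\<close> allows a tree to be grown one vertex at a time inside
  \<open>G\<close>.\<close>

definition rooted_on ::
    "'v pair_pre_digraph \<Rightarrow> 'v \<Rightarrow> ('v \<Rightarrow> 'v) \<Rightarrow> ('v \<Rightarrow> nat) \<Rightarrow> 'v set \<Rightarrow> bool" where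
  "rooted_on G r par depth A \<longleftrightarrow>
     (\<forall>v\<in>A - {r}. par v \<in> A \<and> depth (par v) < depth v) \<and>
     (\<forall>u\<in>A. \<forall>v\<in>A. (u, v) \<in> parcs G \<longleftrightarrow> u \<noteq> r \<and> v = par u \<or> v \<noteq> r \<and> u = par v)"

text \<open>Provides the arc along which a partial tree is extended.\<close>

lemma (in wf_digraph) awalk_leaves:
  assumes "awalk u p v" "u \<in> A" "v \<notin> A"
  shows "\<exists>e\<in>set p. tail G e \<in> A \<and> head G e \<notin> A"
  using assms by (induction p arbitrary: u) (auto simp: awalk_simps)

text \<open>Otherwise a path from \<open>x\<close> to \<open>y\<close> inside \<open>A\<close>,
  which avoids \<open>w\<close>, closes up through \<open>w\<close> to a cycle: two arcs at
  \<open>w\<close> and at least one on the path.\<close>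

lemma (in pair_bidirected_digraph) neighbour_unique:
  assumes acyclic: "\<not> (\<exists>p. cycle p \<and> length p \<ge> 3)"
    and p: "awalk x p y" "set p \<subseteq> A \<times> A" "x \<in> A"
    and w: "(x, w) \<in> parcs G" "(y, w) \<in> parcs G" "w \<notin> A"
  shows "x = y"
proof (rule ccontr)
  assume "x \<noteq> y"
  let ?p = "awalk_to_apath p"
  have path: "apath x ?p y" using p(1) by (rule apath_awalk_to_apath)
  then have walk: "awalk x ?p y" and dist: "distinct (awalk_verts x ?p)" by (auto simp: apath_def)
  have "set ?p \<subseteq> A \<times> A" using awalk_to_apath_subset[OF p(1)] p(2) by auto
  then have "set (awalk_verts x ?p) \<subseteq> A"
    using set_awalk_verts[OF walk] p(3) by auto
  then have wn: "w \<notin> set (awalk_verts x ?p)" using w(3) by auto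
  have "?p \<noteq> []" using walk \<open>x \<noteq> y\<close> by (auto simp: awalk_Nil_iff)
  have closed: "awalk w ((w, x) # ?p @ [(y, w)]) w"
    using walk w arcs_symmetric by (auto simp: awalk_simps in_arcsD2)
  moreover have "awalk_verts w ((w, x) # ?p @ [(y, w)]) = w # awalk_verts x ?p @ [w]"
  proof -
    have "awalk x (?p @ [(y, w)]) w" using closed walk by (simp add: awalk_Cons_iff)
    from awalk_verts_append[OF this] show ?thesis using walk by simp
  qed
  ultimately have "cycle ((w, x) # ?p @ [(y, w)])"
    unfolding cycle_def using dist wn by (intro exI[of _ w]) auto
  moreover have "length ((w, x) # ?p @ [(y, w)]) \<ge> 3"
    using \<open>?p \<noteq> []\<close> by (cases ?p) auto
  ultimately show False using acyclic by blast
qed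

text \<open>A subtree is grown from \<open>r\<close>: connectivity gives an arc leaving it, whose
  end becomes a new leaf, and acyclicity excludes a second arc from the subtree to that
  leaf.\<close>

lemma tree_graph_rooted:
  assumes G: "tree_graph G" and r: "r \<in> pverts G"
  obtains par depth where "rooted_on G r par depth (pverts G)"
proof -
  interpret pair_graph G using G by (simp add: tree_graph_def)
  have acyclic: "\<not> (\<exists>p. cycle p \<and> length p \<ge> 3)" and conn: "Digraph_Component.connected (with_proj G)"
    using G by (auto simp: tree_graph_def)
  have reach: "r \<rightarrow>\<^sup>*\<^bsub>with_proj G\<^esub> z" if "z \<in> pverts G" for z
    using symmetric_connected_imp_strongly_connected[OF pair_sym_arcs conn] r that
    by (auto simp: strongly_connected_def)
  \<comment> \<open>The walks staying inside \<open>A\<close> are carried through the induction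
    because \<open>neighbour_unique\<close> needs a connection that avoids the new vertex.\<close>
  have "\<exists>A par depth. card A = Suc m \<and> A \<subseteq> pverts G \<and> r \<in> A \<and> rooted_on G r par depth A \<and>
      (\<forall>x\<in>A. \<forall>y\<in>A. \<exists>p. awalk x p y \<and> set p \<subseteq> A \<times> A)"
    if "Suc m \<le> card (pverts G)" for m
    using that
  proof (induction m)
    case 0
    have "(r, r) \<notin> parcs G" using pair_no_loops[of "(r, r)"] by auto
    \<comment> \<open>On a single vertex there is no parent and no depth to compare, so any values
      will do.\<close>
    then have "rooted_on G r undefined undefined {r}" by (simp add: rooted_on_def)
    moreover have "awalk r [] r" using r by (simp add: awalk_Nil_iff)
    ultimately show ?case using r by (intro exI[of _ "{r}"] exI[of _ undefined]) force
  next
    case (Suc m)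
    have "Suc m \<le> card (pverts G)" using Suc.prems by simp
    from Suc.IH[OF this] obtain A par depth where A: "card A = Suc m" "A \<subseteq> pverts G" "r \<in> A"
        "rooted_on G r par depth A"
      and walks': "\<forall>x\<in>A. \<forall>y\<in>A. \<exists>p. awalk x p y \<and> set p \<subseteq> A \<times> A"
      by blast
    note walks = walks'[rule_format]
    have finA: "finite A" using A(2) pair_finite_verts by (rule finite_subset)
    have "A \<noteq> pverts G" using A(1) Suc.prems by auto
    then obtain z where z: "z \<in> pverts G" "z \<notin> A" using A(2) by auto
    obtain q where "awalk r q z" using reach[OF z(1)] reachable_awalk by auto
    from awalk_leaves[OF this A(3) z(2)] this
    obtain x w where xw: "(x, w) \<in> parcs G" "x \<in> A" "w \<notin> A" by (auto simp: awalk_def)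
    then have wx: "(w, x) \<in> parcs G" and wV: "w \<in> pverts G" using arcs_symmetric in_arcsD2 by auto
    have uniq: "y = x" if "y \<in> A" "(y, w) \<in> parcs G" for y
      using walks[OF xw(2) that(1)] neighbour_unique[OF acyclic _ _ xw(2) xw(1) that(2) xw(3)] by auto
    have ww: "(w, w) \<notin> parcs G" using pair_no_loops[of "(w, w)"] by auto
    let ?A = "insert w A"
    have "rooted_on G r (par(w := x)) (depth(w := Suc (depth x))) ?A"
      unfolding rooted_on_def
    proof (intro conjI ballI)
      fix u assume u: "u \<in> ?A"
      have wr: "w \<noteq> r" and xw': "x \<noteq> w" using A(3) xw by auto
      have parA: "par v \<in> A" "par v \<noteq> w" "depth (par v) < depth v" if "v \<in> A" "v \<noteq> r" for v
        using A(4) that xw(3) unfolding rooted_on_def by blast+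
      have sym: "(u, v) \<in> parcs G \<longleftrightarrow> (v, u) \<in> parcs G" for u v
        using arcs_symmetric by blast
      have new: "(v, w) \<in> parcs G \<longleftrightarrow> v = x" if "v \<in> A" for v
        using uniq[OF that] xw(1) by blast
      show "(u, v) \<in> parcs G \<longleftrightarrow> u \<noteq> r \<and> v = (par(w := x)) u \<or> v \<noteq> r \<and> u = (par(w := x)) v"
        if v: "v \<in> ?A" for v
      proof -
        have *: "\<not> (v' \<noteq> r \<and> w = par v')" if "v' \<in> A" for v' using parA(2)[OF that] by blast
        consider "u = w" "v = w" | "u = w" "v \<in> A" "v \<noteq> w" | "u \<in> A" "u \<noteq> w" "v = w"
          | "u \<in> A" "u \<noteq> w" "v \<in> A" "v \<noteq> w"
          using u v xw(3) by blast
        then show ?thesis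
        proof cases
          case 1
          then show ?thesis using ww xw' by simp
        next
          case 2
          then show ?thesis using sym[of w v] new[of v] wr *[of v] by auto
        next
          case 3
          then show ?thesis using new[of u] wr *[of u] by auto
        next
          case 4
          then have "(u, v) \<in> parcs G \<longleftrightarrow> u \<noteq> r \<and> v = par u \<or> v \<noteq> r \<and> u = par v"
            using A(4) unfolding rooted_on_def by blast
          then show ?thesis using 4 by simp
        qed
      qed
    next
      fix v assume v: "v \<in> ?A - {r}"
      have parA: "par v \<in> A" "par v \<noteq> w" "depth (par v) < depth v" if "v \<noteq> w"
        using A(4) that xw(3) v unfolding rooted_on_def by blast+
      show "(par(w := x)) v \<in> ?A" using v parA xw(2) by (cases "v = w") auto
      show "(depth(w := Suc (depth x))) ((par(w := x)) v) < (depth(w := Suc (depth x))) v"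
        using v parA xw by (cases "v = w") auto
    qed
    moreover have "\<exists>p. awalk u p v \<and> set p \<subseteq> ?A \<times> ?A" if "u \<in> ?A" "v \<in> ?A" for u v
    proof -
      have to: "\<exists>p. awalk u p x \<and> set p \<subseteq> ?A \<times> ?A" if "u \<in> ?A" for u
      proof (cases "u = w")
        case True
        then show ?thesis using wx xw by (intro exI[of _ "[(w, x)]"]) (auto simp: awalk_simps in_arcsD2)
      next
        case False
        then show ?thesis using walks[of u x] that xw(2) by blast
      qed
      have "from": "\<exists>p. awalk x p u \<and> set p \<subseteq> ?A \<times> ?A" if "u \<in> ?A" for u
      proof (cases "u = w")
        case True
        then show ?thesis using wx xw wV by (intro exI[of _ "[(x, w)]"]) (auto simp: awalk_simps)
      next
        case False
        then show ?thesis using walks[of x u] that xw(2) by blast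
      qed
      obtain p q where "awalk u p x" "set p \<subseteq> ?A \<times> ?A" "awalk x q v" "set q \<subseteq> ?A \<times> ?A"
        using to[OF \<open>u \<in> ?A\<close>] "from"[OF \<open>v \<in> ?A\<close>] by blast
      then show ?thesis by (intro exI[of _ "p @ q"]) (auto intro: awalk_appendI)
    qed
    moreover have "card ?A = Suc (Suc m)" using A(1) finA xw(3) by simp
    ultimately show ?case using A(2,3) wV
      by (intro exI[of _ ?A] exI[of _ "par(w := x)"] exI[of _ "depth(w := Suc (depth x))"]) blast
  qed
  moreover have "card (pverts G) > 0" using r pair_finite_verts by (auto simp: card_gt_0_iff)
  ultimately obtain A par depth where "card A = card (pverts G)" "A \<subseteq> pverts G" "rooted_on G r par depth A"
    by (metis Suc_pred order_refl)
  moreover have "A = pverts G" using calculation pair_finite_verts by (metis card_subset_eq)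
  ultimately show ?thesis using that by blast
qed

text \<open>The neighbours of \<open>v\<close> are its children and its parent; a parent that is
  also a child would have depth both smaller and larger than that of \<open>v\<close>.\<close>

lemma rooted_on_vdegree:
  assumes G: "pair_graph G" and T: "rooted_on G r par depth (pverts G)" and v: "v \<in> pverts G"
  shows "vdegree G v = card {w \<in> pverts G - {r}. par w = v} + of_bool (v \<noteq> r)"
proof -
  interpret pair_graph G by (rule G)
  let ?C = "{w \<in> pverts G - {r}. par w = v}"
  have arc: "(v, w) \<in> parcs G \<longleftrightarrow> v \<noteq> r \<and> w = par v \<or> w \<noteq> r \<and> v = par w" if "w \<in> pverts G" for w
    using T v that unfolding rooted_on_def by blast
  have pv: "par v \<in> pverts G" if "v \<noteq> r"
    using T v that unfolding rooted_on_def by blast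
  have "w \<in> ?C \<union> (if v = r then {} else {par v}) \<longleftrightarrow> (v, w) \<in> parcs G" for w
    using arc[of w] pv in_arcsD2[of v w] by (cases "w \<in> pverts G") auto
  then have "?C \<union> (if v = r then {} else {par v}) = {w. (v, w) \<in> parcs G}" by blast
  moreover have "out_arcs (with_proj G) v = Pair v ` {w. (v, w) \<in> parcs G}"
    by (auto simp: out_arcs_def)
  ultimately have "vdegree G v = card (?C \<union> (if v = r then {} else {par v}))"
    by (simp add: out_degree_def card_image inj_on_def)
  moreover have "par v \<notin> ?C" if "v \<noteq> r"
  proof
    assume *: "par v \<in> ?C"
    have decr: "\<forall>u\<in>pverts G - {r}. depth (par u) < depth u"
      using T by (simp add: rooted_on_def)
    have "depth (par (par v)) < depth (par v)" using decr * by blast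
    moreover have "depth (par v) < depth v" using decr v that by blast
    ultimately show False using * by simp
  qed
  ultimately show ?thesis using pair_finite_verts by auto
qed

text \<open>A deepest vertex of an arbitrary rooting has no children, hence is a leaf, and the tree
  is rooted anew there. With a leaf as root, no vertex has more than \<Delta> - 1 children once
  \<Delta> is at least 2.\<close>

lemma tree_graph_leaf_rooted:
  assumes G: "tree_graph G" and two: "card (pverts G) \<ge> 2"
  obtains r par depth where "r \<in> pverts G" "rooted_on G r par depth (pverts G)" "vdegree G r = 1"
proof -
  interpret pair_graph G using G by (simp add: tree_graph_def)
  obtain r0 where r0: "r0 \<in> pverts G" using two by fastforce
  obtain par depth where T: "rooted_on G r0 par depth (pverts G)"
    using tree_graph_rooted[OF G r0] .
  have "\<not> pverts G \<subseteq> {r0}" using card_mono[of "{r0}" "pverts G"] two by auto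
  then have "depth ` (pverts G - {r0}) \<noteq> {}" "finite (depth ` (pverts G - {r0}))"
    using pair_finite_verts by auto
  from Max_in[OF this(2,1)] Max_ge[OF this(2)]
  obtain l where l: "l \<in> pverts G - {r0}"
    and max: "\<And>w. w \<in> pverts G - {r0} \<Longrightarrow> depth w \<le> depth l"
    by (metis (no_types, lifting) imageE imageI)
  have "par w \<noteq> l" if "w \<in> pverts G - {r0}" for w
  proof -
    have "depth (par w) < depth w" using T that unfolding rooted_on_def by blast
    then show ?thesis using max[OF that] by auto
  qed
  then have none: "{w \<in> pverts G - {r0}. par w = l} = {}" by auto
  have "vdegree G l = 1"
    using rooted_on_vdegree[OF pair_graph_axioms T, of l] l unfolding none by simp
  moreover obtain par' depth' where "rooted_on G l par' depth' (pverts G)"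
    using tree_graph_rooted[OF G, of l] l by auto
  ultimately show ?thesis using that l by auto
qed

section \<open>Second moments on the colourings of a tree\<close>

text \<open>Independence of what happens on \<open>D\<close> and off \<open>D\<close>: exchanging
  the restrictions to \<open>D\<close> is an involution of \<open>W \<times> W\<close> which carries
  \<open>h \<sigma> * f \<tau>\<close> to \<open>h \<sigma> * f \<sigma>\<close>.\<close>

lemma sum_mult_glue:
  fixes W :: "('v \<Rightarrow> 'c) set" and h f :: "('v \<Rightarrow> 'c) \<Rightarrow> real"
  assumes glue: "\<And>\<sigma> \<tau>. \<sigma> \<in> W \<Longrightarrow> \<tau> \<in> W \<Longrightarrow> override_on \<sigma> \<tau> D \<in> W"
    and h: "\<And>\<sigma> \<tau>. \<sigma> \<in> W \<Longrightarrow> \<tau> \<in> W \<Longrightarrow> h (override_on \<sigma> \<tau> D) = h \<sigma>"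
    and f: "\<And>\<sigma> \<tau>. \<sigma> \<in> W \<Longrightarrow> \<tau> \<in> W \<Longrightarrow> f (override_on \<sigma> \<tau> D) = f \<tau>"
  shows "real (card W) * (\<Sum>\<sigma>\<in>W. h \<sigma> * f \<sigma>) = (\<Sum>\<sigma>\<in>W. h \<sigma>) * (\<Sum>\<sigma>\<in>W. f \<sigma>)"
proof -
  define \<phi> where "\<phi> = (\<lambda>(\<sigma> :: 'v \<Rightarrow> 'c, \<tau> :: 'v \<Rightarrow> 'c). (override_on \<sigma> \<tau> D, override_on \<tau> \<sigma> D))"
  have inv: "override_on (override_on \<sigma> \<tau> D) (override_on \<tau> \<sigma> D) D = \<sigma>" for \<sigma> \<tau> :: "'v \<Rightarrow> 'c"
    by (auto simp: override_on_def)
  have "(\<Sum>\<sigma>\<in>W. h \<sigma>) * (\<Sum>\<sigma>\<in>W. f \<sigma>) = (\<Sum>(\<sigma>, \<tau>)\<in>W \<times> W. h \<sigma> * f \<tau>)"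
    by (simp add: sum_product sum.cartesian_product)
  also have "\<dots> = (\<Sum>(\<sigma>, \<tau>)\<in>W \<times> W. h \<sigma> * f \<sigma>)"
    by (rule sum.reindex_bij_witness[where i = \<phi> and j = \<phi>])
       (auto simp: \<phi>_def inv h f intro: glue)
  also have "\<dots> = real (card W) * (\<Sum>\<sigma>\<in>W. h \<sigma> * f \<sigma>)"
    by (simp add: sum.cartesian_product[symmetric] sum_distrib_left)
  finally show ?thesis by simp
qed

text \<open>For total mass at most 1, Cauchy-Schwarz bounds a squared mean by the mean of the
  square. Applied to \<open>f + g\<close> and to \<open>f - g\<close> it gives one sign of the
  covariance each.\<close>

lemma weighted_covariance_bound:
  fixes w f g :: "'c \<Rightarrow> real"
  assumes "\<And>c. c \<in> C \<Longrightarrow> w c \<ge> 0" and "sum w C \<le> 1"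
  shows "2 * \<bar>(\<Sum>c\<in>C. w c * f c * g c) - (\<Sum>c\<in>C. w c * f c) * (\<Sum>c\<in>C. w c * g c)\<bar>
    \<le> (\<Sum>c\<in>C. w c * (f c)\<^sup>2) + (\<Sum>c\<in>C. w c * (g c)\<^sup>2)"
proof -
  have CS: "(\<Sum>c\<in>C. w c * h c)\<^sup>2 \<le> (\<Sum>c\<in>C. w c * (h c)\<^sup>2)" for h :: "'c \<Rightarrow> real"
  proof -
    have "(\<Sum>c\<in>C. w c * h c)\<^sup>2 = (\<Sum>c\<in>C. sqrt (w c) * (sqrt (w c) * h c))\<^sup>2"
      using assms(1) by (simp add: mult.assoc[symmetric] cong: sum.cong)
    also have "\<dots> \<le> (\<Sum>c\<in>C. (sqrt (w c))\<^sup>2) * (\<Sum>c\<in>C. (sqrt (w c) * h c)\<^sup>2)"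
      by (rule Cauchy_Schwarz_ineq_sum)
    also have "\<dots> = sum w C * (\<Sum>c\<in>C. w c * (h c)\<^sup>2)"
      using assms(1) by (simp add: power_mult_distrib cong: sum.cong)
    also have "\<dots> \<le> 1 * (\<Sum>c\<in>C. w c * (h c)\<^sup>2)"
      using assms by (intro mult_right_mono sum_nonneg) auto
    finally show ?thesis by simp
  qed
  have e1: "(\<Sum>c\<in>C. w c * (f c + g c)) = (\<Sum>c\<in>C. w c * f c) + (\<Sum>c\<in>C. w c * g c)"
    "(\<Sum>c\<in>C. w c * (f c - g c)) = (\<Sum>c\<in>C. w c * f c) - (\<Sum>c\<in>C. w c * g c)"
    by (simp_all add: algebra_simps sum.distrib sum_subtractf)
  have e2: "(\<Sum>c\<in>C. w c * (f c + g c)\<^sup>2)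
      = (\<Sum>c\<in>C. w c * (f c)\<^sup>2) + 2 * (\<Sum>c\<in>C. w c * f c * g c) + (\<Sum>c\<in>C. w c * (g c)\<^sup>2)"
    "(\<Sum>c\<in>C. w c * (f c - g c)\<^sup>2)
      = (\<Sum>c\<in>C. w c * (f c)\<^sup>2) - 2 * (\<Sum>c\<in>C. w c * f c * g c) + (\<Sum>c\<in>C. w c * (g c)\<^sup>2)"
    by (simp_all add: power2_eq_square algebra_simps sum.distrib sum_subtractf sum_distrib_left)
  have sq: "2 * \<bar>m - x * y\<bar> \<le> a + b"
    if "(x + y)\<^sup>2 \<le> a + 2 * m + b" "(x - y)\<^sup>2 \<le> a - 2 * m + b" for a b m x y :: real
  proof -
    have "0 \<le> x\<^sup>2" "0 \<le> y\<^sup>2" by simp_all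
    then have "m - x * y \<le> (a + b) / 2" "x * y - m \<le> (a + b) / 2"
      using that unfolding power2_sum power2_diff by argo+
    then show ?thesis by argo
  qed
  show ?thesis
    using CS[of "\<lambda>c. f c + g c"] CS[of "\<lambda>c. f c - g c"] unfolding e1 e2 by (rule sq)
qed

lemma sum_off_diagonal:
  fixes \<beta> :: "'c \<Rightarrow> real"
  assumes "finite C" "c \<in> C"
  shows "(\<Sum>b\<in>C. \<beta> b * of_bool (c \<noteq> b)) = sum \<beta> C - \<beta> c"
proof -
  have "(\<Sum>b\<in>C. \<beta> b * of_bool (c \<noteq> b)) = (\<Sum>b\<in>C. \<beta> b - (if b = c then \<beta> b else 0))"
    by (intro sum.cong) auto
  also have "\<dots> = sum \<beta> C - \<beta> c"
    using assms by (simp add: sum_subtractf)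
  finally show ?thesis .
qed

text \<open>
  Two independent colours conditioned on being different. As \<open>f\<close> has mean zero under the
  conditioned law, \<open>\<Sum> \<alpha> f = \<Sum> \<alpha> \<beta> f\<close>, and likewise for \<open>g\<close>; hence the correlation is, up to
  sign, a covariance with respect to the subprobability \<open>\<alpha> \<beta>\<close>.
\<close>

lemma disequality_correlation_bound:
  fixes \<alpha> \<beta> f g :: "'c \<Rightarrow> real"
  assumes C: "finite C" and \<kappa>: "\<kappa> > 0"
    and \<alpha>: "\<And>c. c \<in> C \<Longrightarrow> \<alpha> c \<ge> 0" "sum \<alpha> C = 1" "\<And>c. c \<in> C \<Longrightarrow> (\<kappa> + 1) * \<alpha> c \<le> 1"
    and \<beta>: "\<And>c. c \<in> C \<Longrightarrow> \<beta> c \<ge> 0" "sum \<beta> C = 1" "\<And>c. c \<in> C \<Longrightarrow> (\<kappa> + 1) * \<beta> c \<le> 1"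
    and f: "(\<Sum>c\<in>C. \<alpha> c * (1 - \<beta> c) * f c) = 0"
    and g: "(\<Sum>c\<in>C. \<beta> c * (1 - \<alpha> c) * g c) = 0"
  shows "2 * \<bar>\<Sum>c\<in>C. \<Sum>b\<in>C. \<alpha> c * \<beta> b * of_bool (c \<noteq> b) * (f c * g b)\<bar>
    \<le> (1 / \<kappa>) * ((\<Sum>c\<in>C. \<alpha> c * (1 - \<beta> c) * (f c)\<^sup>2) + (\<Sum>c\<in>C. \<beta> c * (1 - \<alpha> c) * (g c)\<^sup>2))"
proof -
  define w where "w c = \<alpha> c * \<beta> c" for c
  have le1: "\<alpha> c \<le> 1" "\<beta> c \<le> 1" if "c \<in> C" for c
    using member_le_sum[of c C \<alpha>] member_le_sum[of c C \<beta>] \<alpha> \<beta> C that by simp_all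
  have w0: "w c \<ge> 0" if "c \<in> C" for c
    using \<alpha>(1) \<beta>(1) that by (simp add: w_def)
  have "sum w C \<le> sum \<alpha> C"
    unfolding w_def using \<alpha>(1) le1 by (intro sum_mono) (simp add: mult_left_le)
  then have w1: "sum w C \<le> 1" using \<alpha>(2) by simp
  have F: "(\<Sum>c\<in>C. \<alpha> c * f c) = (\<Sum>c\<in>C. w c * f c)"
    using f by (simp add: w_def algebra_simps sum_subtractf)
  have G: "(\<Sum>c\<in>C. \<beta> c * g c) = (\<Sum>c\<in>C. w c * g c)"
    using g by (simp add: w_def algebra_simps sum_subtractf)
  have "(\<Sum>c\<in>C. \<Sum>b\<in>C. \<alpha> c * \<beta> b * of_bool (c \<noteq> b) * (f c * g b))
      = (\<Sum>c\<in>C. \<alpha> c * f c * (\<Sum>b\<in>C. (\<beta> b * g b) * of_bool (c \<noteq> b)))"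
    unfolding sum_distrib_left by (intro sum.cong refl) (simp add: mult_ac)
  also have "\<dots> = (\<Sum>c\<in>C. \<alpha> c * f c * ((\<Sum>b\<in>C. \<beta> b * g b) - \<beta> c * g c))"
    by (intro sum.cong refl arg_cong2[where f = "(*)"] sum_off_diagonal C)
  also have "\<dots> = (\<Sum>c\<in>C. \<alpha> c * f c) * (\<Sum>c\<in>C. \<beta> c * g c) - (\<Sum>c\<in>C. w c * f c * g c)"
    by (simp add: w_def right_diff_distrib sum_subtractf sum_distrib_right mult_ac)
  finally have "2 * \<bar>\<Sum>c\<in>C. \<Sum>b\<in>C. \<alpha> c * \<beta> b * of_bool (c \<noteq> b) * (f c * g b)\<bar>
      = 2 * \<bar>(\<Sum>c\<in>C. w c * f c * g c) - (\<Sum>c\<in>C. w c * f c) * (\<Sum>c\<in>C. w c * g c)\<bar>"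
    unfolding F G by (simp add: abs_minus_commute)
  also have "\<dots> \<le> (\<Sum>c\<in>C. w c * (f c)\<^sup>2) + (\<Sum>c\<in>C. w c * (g c)\<^sup>2)"
    by (rule weighted_covariance_bound[OF w0 w1])
  also have "\<dots> \<le> (\<Sum>c\<in>C. (1 / \<kappa>) * (\<alpha> c * (1 - \<beta> c) * (f c)\<^sup>2))
      + (\<Sum>c\<in>C. (1 / \<kappa>) * (\<beta> c * (1 - \<alpha> c) * (g c)\<^sup>2))"
  proof (intro add_mono sum_mono)
    \<comment> \<open>The source of the factor \<open>1 / \<kappa>\<close>: a value of probability
      at most 1 / (\<kappa> + 1) satisfies \<kappa> y \<le> 1 - y, so the weight \<alpha> \<beta> is
      dominated by the marginals \<alpha> (1 - \<beta>) and \<beta> (1 - \<alpha>) of the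
      conditioned law.\<close>
    have key: "x * y \<le> (1 / \<kappa>) * (x * (1 - y))" if "x \<ge> 0" "(\<kappa> + 1) * y \<le> 1" for x y :: real
    proof -
      have "x * (\<kappa> * y) \<le> x * (1 - y)"
        using that by (intro mult_left_mono) (auto simp: algebra_simps)
      then show ?thesis using \<kappa> by (simp add: field_simps)
    qed
    fix c assume c: "c \<in> C"
    show "w c * (f c)\<^sup>2 \<le> (1 / \<kappa>) * (\<alpha> c * (1 - \<beta> c) * (f c)\<^sup>2)"
      using mult_right_mono[OF key[OF \<alpha>(1) \<beta>(3), OF c c], of "(f c)\<^sup>2"]
      by (simp add: w_def mult_ac)
    show "w c * (g c)\<^sup>2 \<le> (1 / \<kappa>) * (\<beta> c * (1 - \<alpha> c) * (g c)\<^sup>2)"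
      using mult_right_mono[OF key[OF \<beta>(1) \<alpha>(3), OF c c], of "(g c)\<^sup>2"]
      by (simp add: w_def mult_ac)
  qed
  finally show ?thesis by (simp add: sum_distrib_left distrib_left)
qed

section \<open>Coloured trees: subtrees, gluing and recolouring\<close>

text \<open>
  A rooted tree on \<open>V\<close>, its edges being named by their lower end points, so that a set of
  edges is a subset of \<open>V - {r}\<close>. The vertices outside \<open>U\<close> carry the prescribed colours \<open>t\<close>.
\<close>

locale coloured_tree =
  fixes V :: "'v set" and r :: 'v and par :: "'v \<Rightarrow> 'v" and depth :: "'v \<Rightarrow> nat"
    and L :: "'v \<Rightarrow> 'c set" and U :: "'v set" and t :: "'v \<Rightarrow> 'c" and \<kappa> :: real
  assumes finite_V: "finite V"
    and root: "r \<in> V"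
    and par: "\<And>v. v \<in> V - {r} \<Longrightarrow> par v \<in> V"
    and depth: "\<And>v. v \<in> V - {r} \<Longrightarrow> depth (par v) < depth v"
    and finite_L: "\<And>v. v \<in> V \<Longrightarrow> finite (L v)"
    and U: "U \<subseteq> V"
    and \<kappa>: "\<kappa> > 0"
    and lists: "\<And>v. v \<in> U \<Longrightarrow>
      \<kappa> + real (card {w \<in> V - {r}. par w = v} + of_bool (v \<noteq> r)) \<le> real (card (L v))"
begin

text \<open>The edge set is a parameter so that a single edge can be deleted. Extensional functions
  represent each colouring of \<open>V\<close> exactly once, as counting requires.\<close>

definition colourings :: "'v set \<Rightarrow> ('v \<Rightarrow> 'c) set" where
  "colourings F =
     {\<sigma> \<in> Pi\<^sub>E V L. (\<forall>v\<in>F. \<sigma> v \<noteq> \<sigma> (par v)) \<and> (\<forall>v\<in>V - U. \<sigma> v = t v)}"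

abbreviation "\<Omega> \<equiv> colourings (V - {r})"

lemma finite_colourings [simp]: "finite (colourings F)"
  unfolding colourings_def using finite_PiE[OF finite_V finite_L] by auto

inductive_set descendants :: "'v \<Rightarrow> 'v set" for l where
  self: "l \<in> descendants l"
| child: "v \<in> V - {r} \<Longrightarrow> par v \<in> descendants l \<Longrightarrow> v \<in> descendants l"

lemma descendants_depth: "v \<in> descendants l \<Longrightarrow> depth l \<le> depth v"
  by (induction rule: descendants.induct) (use depth in \<open>auto intro: less_imp_le order_trans\<close>)

lemma par_notin_descendants: "l \<in> V - {r} \<Longrightarrow> par l \<notin> descendants l"
  using depth[of l] descendants_depth[of "par l" l] by auto

lemma par_in_descendants_iff:
  "v \<in> V - {r} \<Longrightarrow> v \<noteq> l \<Longrightarrow> par v \<in> descendants l \<longleftrightarrow> v \<in> descendants l"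
  by (auto intro: descendants.child elim: descendants.cases)

text \<open>Applied to the vertices left after removing a leaf \<open>l\<close>: no function of
  their colours sees a change below \<open>l\<close>.\<close>

lemma descendants_disjoint:
  assumes "\<And>v. v \<in> A - {r} \<Longrightarrow> par v \<in> A" "l \<notin> A" "v \<in> descendants l"
  shows "v \<notin> A"
  using assms(3) by (induction rule: descendants.induct) (use assms(1,2) in auto)

text \<open>The edge from \<open>l\<close> to its parent is the only one joining the subtree below
  \<open>l\<close> to the rest. Exchanging the subtree can violate no other edge, and this one
  survives if the parent has the same colour in both colourings.\<close>

lemma glue_colourings:
  assumes l: "l \<in> V - {r}" and F: "F \<subseteq> V - {r}"
    and \<sigma>: "\<sigma> \<in> colourings F" and \<tau>: "\<tau> \<in> colourings F"
    and agree: "l \<in> F \<Longrightarrow> \<sigma> (par l) = \<tau> (par l)"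
  shows "override_on \<sigma> \<tau> (descendants l) \<in> colourings F"
proof -
  let ?\<rho> = "override_on \<sigma> \<tau> (descendants l)"
  have "?\<rho> v \<noteq> ?\<rho> (par v)" if v: "v \<in> F" for v
  proof (cases "v = l")
    case True
    then show ?thesis
      using l v \<tau> agree par_notin_descendants[OF l] descendants.self[of l]
      by (auto simp: colourings_def)
  next
    case False
    then have "par v \<in> descendants l \<longleftrightarrow> v \<in> descendants l"
      using v F by (intro par_in_descendants_iff) auto
    then show ?thesis
      using v \<sigma> \<tau> by (cases "v \<in> descendants l") (auto simp: colourings_def)
  qed
  then show ?thesis
    using \<sigma> \<tau> by (auto simp: colourings_def PiE_iff extensional_def override_on_def)
qed

text \<open>From a colouring with \<sigma> v = c, changing the colour of \<open>v\<close> to any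
  colour of its list that no neighbour carries gives at least \<kappa> + 1 colourings, itself
  included. The resulting map is injective because the overwritten colour is always
  \<open>c\<close>.\<close>

lemma recolour_bound:
  assumes v: "v \<in> U" and F: "F \<subseteq> V - {r}"
    and room: "\<kappa> + 1 + real (card ({w \<in> F. par w = v} \<union> (if v \<in> F then {par v} else {})))
      \<le> real (card (L v))"
  shows "(\<kappa> + 1) * real (card {\<sigma> \<in> colourings F. \<sigma> v = c}) \<le> real (card (colourings F))"
proof -
  define N where "N = {w \<in> F. par w = v} \<union> (if v \<in> F then {par v} else {})"
  define A where "A = {\<sigma> \<in> colourings F. \<sigma> v = c}"
  have vV: "v \<in> V" using v U by auto
  have finA: "finite A" by (simp add: A_def)
  have finN: "finite N" using F finite_V by (auto simp: N_def intro: finite_subset)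
  have loopfree: "par w \<noteq> w" if "w \<in> F" for w
    using depth[of w] F that by fastforce
  have "card (SIGMA \<sigma>:A. L v - \<sigma> ` N) \<le> card (colourings F)"
  proof (rule card_inj_on_le[where f = "\<lambda>(\<sigma>, d). \<sigma>(v := d)"])
    show "inj_on (\<lambda>(\<sigma>, d). \<sigma>(v := d)) (SIGMA \<sigma>:A. L v - \<sigma> ` N)"
    proof (rule inj_onI, clarify)
      fix \<sigma> d \<sigma>' d' assume "\<sigma> \<in> A" "\<sigma>' \<in> A" and eq: "\<sigma>(v := d) = \<sigma>'(v := d')"
      then have "\<sigma> v = \<sigma>' v" by (simp add: A_def)
      then show "\<sigma> = \<sigma>' \<and> d = d'" using eq by (metis fun_upd_eqD fun_upd_triv fun_upd_upd)
    qed
    show "(\<lambda>(\<sigma>, d). \<sigma>(v := d)) ` (SIGMA \<sigma>:A. L v - \<sigma> ` N) \<subseteq> colourings F"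
    proof clarify
      fix \<sigma> d assume \<sigma>: "\<sigma> \<in> A" and d: "d \<in> L v" "d \<notin> \<sigma> ` N"
      have "(\<sigma>(v := d)) w \<noteq> (\<sigma>(v := d)) (par w)" if w: "w \<in> F" for w
        using \<sigma> d w loopfree[OF w] by (auto simp: A_def colourings_def N_def)
      then show "\<sigma>(v := d) \<in> colourings F"
        using \<sigma> d vV v by (auto simp: A_def colourings_def PiE_iff extensional_def)
    qed
  qed simp
  moreover have "(\<kappa> + 1) * card A \<le> card (SIGMA \<sigma>:A. L v - \<sigma> ` N)"
  proof -
    have "\<kappa> + 1 \<le> card (L v - \<sigma> ` N)" for \<sigma>
    proof -
      have "card (L v) - card N \<le> card (L v - \<sigma> ` N)"
        using diff_card_le_card_Diff[of "\<sigma> ` N" "L v"] card_image_le[OF finN, of \<sigma>] finN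
        by simp
      then show ?thesis using room by (simp add: N_def)
    qed
    then have "(\<Sum>\<sigma>\<in>A. \<kappa> + 1) \<le> (\<Sum>\<sigma>\<in>A. real (card (L v - \<sigma> ` N)))"
      by (intro sum_mono)
    then show ?thesis
      using finA finite_L[OF vV] by (simp add: mult.commute)
  qed
  ultimately show ?thesis by (simp add: A_def)
qed

text \<open>Deleting the edge lowers the degree of both its end points by one, which raises the
  surplus of their lists from \<kappa> to \<kappa> + 1.\<close>

lemma edge_room:
  assumes l: "l \<in> V - {r}" and v: "v \<in> U" "v = l \<or> v = par l"
  shows "\<kappa> + 1 + real (card ({w \<in> V - {r} - {l}. par w = v}
           \<union> (if v \<in> V - {r} - {l} then {par v} else {}))) \<le> real (card (L v))"
proof -
  define N where "N = {w \<in> V - {r} - {l}. par w = v}"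
  have finN: "finite N" using finite_V by (simp add: N_def)
  show ?thesis
  proof (cases "v = l")
    case True
    have "par l \<noteq> l" using depth[OF l] by auto
    then have "{w \<in> V - {r} - {l}. par w = v} = {w \<in> V - {r}. par w = v}"
      using True by auto
    then show ?thesis using lists[OF v(1)] l True by simp
  next
    case False
    then have pl: "par l = v" using v by auto
    have vV: "v \<in> V" using v U by auto
    have "{w \<in> V - {r}. par w = v} = insert l N" using l pl by (auto simp: N_def)
    then have c: "card {w \<in> V - {r}. par w = v} = Suc (card N)"
      using finN by (simp add: N_def)
    have "card (N \<union> (if v \<in> V - {r} - {l} then {par v} else {})) \<le> card N + of_bool (v \<noteq> r)"
      using card_Un_le[of N "if v \<in> V - {r} - {l} then {par v} else {}"] by (auto split: if_splits)
    then show ?thesis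
      using lists[OF v(1)] c False vV unfolding N_def[symmetric] by (auto split: if_splits)
  qed
qed

section \<open>Correlation of the two colours at an edge\<close>

text \<open>\<open>W\<close> consists of the colourings with the edge deleted, and \<alpha>, \<beta>
  are the laws under \<open>W\<close> of the colours at its end points. These are independent by
  gluing, small by recolouring, and \<Omega> is the part of \<open>W\<close> where they differ, so
  \<open>disequality_correlation_bound\<close> applies.\<close>

lemma edge_correlation_free:
  assumes l: "l \<in> V - {r}" and free: "l \<in> U" "par l \<in> U"
    and f: "(\<Sum>\<sigma>\<in>\<Omega>. f (\<sigma> (par l))) = 0" and g: "(\<Sum>\<sigma>\<in>\<Omega>. g (\<sigma> l)) = 0"
  shows "2 * \<bar>\<Sum>\<sigma>\<in>\<Omega>. f (\<sigma> (par l)) * g (\<sigma> l)\<bar>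
    \<le> (1 / \<kappa>) * ((\<Sum>\<sigma>\<in>\<Omega>. (f (\<sigma> (par l)))\<^sup>2) + (\<Sum>\<sigma>\<in>\<Omega>. (g (\<sigma> l))\<^sup>2))"
proof -
  define W where "W = colourings (V - {r} - {l})"
  define p where "p = par l"
  define C where "C = L p \<union> L l"
  define m where "m = real (card W)"
  define \<alpha> where "\<alpha> c = (\<Sum>\<sigma>\<in>W. of_bool (\<sigma> p = c)) / m" for c
  define \<beta> where "\<beta> c = (\<Sum>\<sigma>\<in>W. of_bool (\<sigma> l = c)) / m" for c
  have pV: "p \<in> V" and lV: "l \<in> V" using l par by (auto simp: p_def)
  have \<Omega>: "\<Omega> = {\<sigma> \<in> W. \<sigma> p \<noteq> \<sigma> l}"
  proof -
    have "\<Omega> = colourings (insert l (V - {r} - {l}))" using l by (simp add: insert_absorb)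
    then show ?thesis unfolding W_def p_def by (auto simp: colourings_def)
  qed
  have C: "finite C" using finite_L pV lV by (simp add: C_def)
  have finW: "finite W" by (simp add: W_def)
  have inC: "\<sigma> p \<in> C" "\<sigma> l \<in> C" if "\<sigma> \<in> W" for \<sigma>
    using that pV lV by (auto simp: W_def colourings_def C_def)
  show ?thesis
  proof (cases "W = {}")
    case True
    then show ?thesis using \<Omega> by simp
  next
    case False
    then have m: "m > 0" using finW by (simp add: m_def card_gt_0_iff)
    have indep: "(\<Sum>\<sigma>\<in>W. of_bool (\<sigma> p = c) * of_bool (\<sigma> l = b)) = m * (\<alpha> c * \<beta> b)" for c b
    proof -
      have "m * (\<Sum>\<sigma>\<in>W. of_bool (\<sigma> p = c) * of_bool (\<sigma> l = b))
          = (\<Sum>\<sigma>\<in>W. of_bool (\<sigma> p = c)) * (\<Sum>\<sigma>\<in>W. of_bool (\<sigma> l = b))"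
        unfolding m_def
        by (rule sum_mult_glue[where D = "descendants l"])
           (use par_notin_descendants[OF l] descendants.self[of l] in
            \<open>auto simp: W_def p_def intro!: glue_colourings[OF l]\<close>)
      then show ?thesis using m by (simp add: \<alpha>_def \<beta>_def field_simps)
    qed
    \<comment> \<open>All sums over \<Omega> that are needed depend on the two end colours only; the
      factor \<open>m\<close> appears since \<alpha> and \<beta> are normalised by
      \<open>card W\<close>.\<close>
    have joint: "(\<Sum>\<sigma>\<in>\<Omega>. K (\<sigma> p) (\<sigma> l))
        = m * (\<Sum>c\<in>C. \<Sum>b\<in>C. \<alpha> c * \<beta> b * of_bool (c \<noteq> b) * K c b)" for K :: "'c \<Rightarrow> 'c \<Rightarrow> real"
    proof -
      have "(\<Sum>\<sigma>\<in>\<Omega>. K (\<sigma> p) (\<sigma> l)) = (\<Sum>\<sigma>\<in>W. of_bool (\<sigma> p \<noteq> \<sigma> l) * K (\<sigma> p) (\<sigma> l))"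
        unfolding \<Omega> using finW by (simp add: sum.If_cases Int_def of_bool_def if_distrib[of "\<lambda>x. x * _"] cong: if_cong)
      also have "\<dots> = (\<Sum>\<sigma>\<in>W. \<Sum>c\<in>C. \<Sum>b\<in>C. (of_bool (c \<noteq> b) * K c b)
          * (of_bool (\<sigma> p = c) * of_bool (\<sigma> l = b)))"
      proof (rule sum.cong[OF refl])
        fix \<sigma> assume "\<sigma> \<in> W"
        note i = inC[OF this]
        have "(\<Sum>c\<in>C. \<Sum>b\<in>C. (of_bool (c \<noteq> b) * K c b) * (of_bool (\<sigma> p = c) * of_bool (\<sigma> l = b)))
            = (\<Sum>c\<in>C. if c = \<sigma> p then (\<Sum>b\<in>C. if b = \<sigma> l then of_bool (c \<noteq> b) * K c b else 0) else 0)"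
          by (intro sum.cong refl) (auto intro!: sum.cong)
        then show "of_bool (\<sigma> p \<noteq> \<sigma> l) * K (\<sigma> p) (\<sigma> l)
          = (\<Sum>c\<in>C. \<Sum>b\<in>C. (of_bool (c \<noteq> b) * K c b) * (of_bool (\<sigma> p = c) * of_bool (\<sigma> l = b)))"
          using i C by simp
      qed
      also have "\<dots> = (\<Sum>c\<in>C. \<Sum>b\<in>C. \<Sum>\<sigma>\<in>W. (of_bool (c \<noteq> b) * K c b)
          * (of_bool (\<sigma> p = c) * of_bool (\<sigma> l = b)))"
        by (subst sum.swap, intro sum.cong refl, subst sum.swap) simp
      also have "\<dots> = (\<Sum>c\<in>C. \<Sum>b\<in>C. (of_bool (c \<noteq> b) * K c b) * (m * (\<alpha> c * \<beta> b)))"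
        unfolding sum_distrib_left[symmetric] indep ..
      finally show ?thesis
        unfolding sum_distrib_left by (simp only: mult_ac)
    qed
    have \<alpha>0: "\<alpha> c \<ge> 0" and \<beta>0: "\<beta> c \<ge> 0" for c
      using m by (auto simp: \<alpha>_def \<beta>_def intro!: divide_nonneg_pos sum_nonneg)
    have total: "(\<Sum>c\<in>C. (\<Sum>\<sigma>\<in>W. of_bool (\<sigma> v = c)) / m) = 1" if "v = p \<or> v = l" for v
    proof -
      have "(\<Sum>c\<in>C. \<Sum>\<sigma>\<in>W. of_bool (\<sigma> v = c)) = (\<Sum>\<sigma>\<in>W. \<Sum>c\<in>C. if c = \<sigma> v then 1 else (0::real))"
        by (subst sum.swap) (auto intro!: sum.cong)
      also have "\<dots> = m" using inC C that by (auto simp: m_def)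
      finally show ?thesis using m by (simp add: sum_divide_distrib[symmetric])
    qed
    have \<alpha>1: "sum \<alpha> C = 1" and \<beta>1: "sum \<beta> C = 1"
      unfolding \<alpha>_def \<beta>_def by (auto intro: total)
    have small: "(\<kappa> + 1) * ((\<Sum>\<sigma>\<in>W. of_bool (\<sigma> v = c)) / m) \<le> 1"
      if "v = p \<or> v = l" for v c
    proof -
      have "(\<kappa> + 1) * card {\<sigma> \<in> W. \<sigma> v = c} \<le> m"
        unfolding W_def m_def using that free l
        by (intro recolour_bound edge_room) (auto simp: p_def)
      then show ?thesis using m finW by (simp add: sum.If_cases Int_def of_bool_def)
    qed
    have \<alpha>2: "(\<kappa> + 1) * \<alpha> c \<le> 1" for c
      unfolding \<alpha>_def by (rule small) simp
    have \<beta>2: "(\<kappa> + 1) * \<beta> c \<le> 1" for c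
      unfolding \<beta>_def by (rule small) simp
    \<comment> \<open>Letting the kernel ignore one colour yields the conditioned marginals, which
      are the weights in \<open>disequality_correlation_bound\<close>.\<close>
    have marg_p: "(\<Sum>\<sigma>\<in>\<Omega>. h (\<sigma> p)) = m * (\<Sum>c\<in>C. \<alpha> c * (1 - \<beta> c) * h c)" for h :: "'c \<Rightarrow> real"
    proof -
      have "(\<Sum>\<sigma>\<in>\<Omega>. h (\<sigma> p)) = m * (\<Sum>c\<in>C. \<Sum>b\<in>C. \<alpha> c * \<beta> b * of_bool (c \<noteq> b) * h c)"
        by (rule joint)
      also have "\<dots> = m * (\<Sum>c\<in>C. \<alpha> c * h c * (\<Sum>b\<in>C. \<beta> b * of_bool (c \<noteq> b)))"
        unfolding sum_distrib_left[of "\<alpha> _ * h _"] by (simp only: mult_ac)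
      also have "\<dots> = m * (\<Sum>c\<in>C. \<alpha> c * h c * (1 - \<beta> c))"
        using sum_off_diagonal[OF C, of _ \<beta>] \<beta>1 by simp
      finally show ?thesis by (simp only: mult_ac)
    qed
    have marg_l: "(\<Sum>\<sigma>\<in>\<Omega>. h (\<sigma> l)) = m * (\<Sum>c\<in>C. \<beta> c * (1 - \<alpha> c) * h c)" for h :: "'c \<Rightarrow> real"
    proof -
      have "(\<Sum>\<sigma>\<in>\<Omega>. h (\<sigma> l)) = m * (\<Sum>c\<in>C. \<Sum>b\<in>C. \<alpha> c * \<beta> b * of_bool (c \<noteq> b) * h b)"
        by (rule joint)
      also have "\<dots> = m * (\<Sum>b\<in>C. \<Sum>c\<in>C. \<alpha> c * \<beta> b * of_bool (b \<noteq> c) * h b)"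
        by (subst sum.swap) (simp only: eq_commute)
      also have "\<dots> = m * (\<Sum>b\<in>C. \<beta> b * h b * (\<Sum>c\<in>C. \<alpha> c * of_bool (b \<noteq> c)))"
        unfolding sum_distrib_left[of "\<beta> _ * h _"] by (simp only: mult_ac)
      also have "\<dots> = m * (\<Sum>b\<in>C. \<beta> b * h b * (1 - \<alpha> b))"
        using sum_off_diagonal[OF C, of _ \<alpha>] \<alpha>1 by simp
      finally show ?thesis by (simp only: mult_ac)
    qed
    have "2 * \<bar>\<Sum>c\<in>C. \<Sum>b\<in>C. \<alpha> c * \<beta> b * of_bool (c \<noteq> b) * (f c * g b)\<bar>
      \<le> (1 / \<kappa>) * ((\<Sum>c\<in>C. \<alpha> c * (1 - \<beta> c) * (f c)\<^sup>2) + (\<Sum>c\<in>C. \<beta> c * (1 - \<alpha> c) * (g c)\<^sup>2))"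
      using f g m marg_p[of f] marg_l[of g]
      by (intro disequality_correlation_bound C \<kappa> \<alpha>0 \<beta>0 \<alpha>1 \<beta>1 \<alpha>2 \<beta>2) (auto simp: p_def)
    from mult_left_mono[OF this, of m] m show ?thesis
      unfolding p_def[symmetric] joint[of "\<lambda>c b. f c * g b"] marg_p[of "\<lambda>c. (f c)\<^sup>2"] marg_l[of "\<lambda>c. (g c)\<^sup>2"]
      by (simp add: abs_mult algebra_simps)
  qed
qed

text \<open>The colour of a pinned vertex is constant on \<Omega>, and a constant of mean zero
  vanishes.\<close>

lemma pinned_colour:
  assumes "v \<in> V - U" "(\<Sum>\<sigma>\<in>\<Omega>. f (\<sigma> v)) = (0::real)" "\<sigma> \<in> \<Omega>"
  shows "f (\<sigma> v) = 0"
proof -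
  have "(\<Sum>\<sigma>\<in>\<Omega>. f (\<sigma> v)) = (\<Sum>\<sigma>\<in>\<Omega>. f (t v))"
    using assms(1) by (intro sum.cong) (auto simp: colourings_def)
  then have "f (t v) = 0" using assms(2,3) finite_colourings[of "V - {r}"] by auto
  then show ?thesis using assms(1,3) by (simp add: colourings_def)
qed

text \<open>If an end point is pinned, one factor of every product is zero by
  \<open>pinned_colour\<close>; otherwise both ends are free.\<close>

lemma edge_correlation:
  assumes l: "l \<in> V - {r}"
    and f: "(\<Sum>\<sigma>\<in>\<Omega>. f (\<sigma> (par l))) = 0" and g: "(\<Sum>\<sigma>\<in>\<Omega>. g (\<sigma> l)) = 0"
  shows "2 * \<bar>\<Sum>\<sigma>\<in>\<Omega>. f (\<sigma> (par l)) * g (\<sigma> l)\<bar>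
    \<le> (1 / \<kappa>) * ((\<Sum>\<sigma>\<in>\<Omega>. (f (\<sigma> (par l)))\<^sup>2) + (\<Sum>\<sigma>\<in>\<Omega>. (g (\<sigma> l))\<^sup>2))"
proof (cases "l \<in> U \<and> par l \<in> U")
  case True
  then show ?thesis using edge_correlation_free[of l f g] l f g by simp
next
  case False
  have "f (\<sigma> (par l)) = 0 \<or> g (\<sigma> l) = 0" if "\<sigma> \<in> \<Omega>" for \<sigma>
    using pinned_colour[OF _ f that] pinned_colour[OF _ g that] l par[OF l] False by auto
  then have "(\<Sum>\<sigma>\<in>\<Omega>. f (\<sigma> (par l)) * g (\<sigma> l)) = 0"
    by (intro sum.neutral) auto
  then show ?thesis using \<kappa> by (simp add: sum_nonneg)
qed

section \<open>Elimination of leaves and the growth of the variance\<close>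

text \<open>\<open>g\<close> is the conditional expectation of \<open>f (\<sigma> l)\<close> given
  the colour of the parent. Once that colour is fixed, the subtree below \<open>l\<close> is
  independent of the rest, so \<open>g\<close> replaces \<open>f\<close> against any
  \<open>h\<close> that ignores the subtree.\<close>

lemma edge_projection:
  assumes l: "l \<in> V - {r}" and f: "(\<Sum>\<sigma>\<in>\<Omega>. f (\<sigma> l)) = (0::real)"
  obtains g where "(\<Sum>\<sigma>\<in>\<Omega>. g (\<sigma> (par l))) = 0"
    and "(\<Sum>\<sigma>\<in>\<Omega>. (g (\<sigma> (par l)))\<^sup>2) \<le> (1 / \<kappa>)\<^sup>2 * (\<Sum>\<sigma>\<in>\<Omega>. (f (\<sigma> l))\<^sup>2)"
    and "\<And>h. (\<And>\<sigma> \<tau>. h (override_on \<sigma> \<tau> (descendants l)) = h \<sigma>) \<Longrightarrow>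
      (\<Sum>\<sigma>\<in>\<Omega>. h \<sigma> * f (\<sigma> l)) = (\<Sum>\<sigma>\<in>\<Omega>. h \<sigma> * g (\<sigma> (par l)))"
proof
  define p where "p = par l"
  define W where "W c = {\<sigma> \<in> \<Omega>. \<sigma> p = c}" for c
  define g where "g c = (\<Sum>\<sigma>\<in>W c. f (\<sigma> l)) / real (card (W c))" for c
  have fin: "finite (W c)" for c by (simp add: W_def)
  have D: "l \<in> descendants l" "p \<notin> descendants l"
    using descendants.self par_notin_descendants[OF l] by (auto simp: p_def)
  show *: "(\<Sum>\<sigma>\<in>\<Omega>. h \<sigma> * f (\<sigma> l)) = (\<Sum>\<sigma>\<in>\<Omega>. h \<sigma> * g (\<sigma> (par l)))"
    if h: "\<And>\<sigma> \<tau>. h (override_on \<sigma> \<tau> (descendants l)) = h \<sigma>" for h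
  proof -
    have fibre: "(\<Sum>\<sigma>\<in>W c. h \<sigma> * f (\<sigma> l)) = (\<Sum>\<sigma>\<in>W c. h \<sigma> * g (\<sigma> p))" for c
    proof (cases "W c = {}")
      case False
      have "card (W c) * (\<Sum>\<sigma>\<in>W c. h \<sigma> * f (\<sigma> l)) = (\<Sum>\<sigma>\<in>W c. h \<sigma>) * (\<Sum>\<sigma>\<in>W c. f (\<sigma> l))"
        by (rule sum_mult_glue[where D = "descendants l"])
           (use D h in \<open>auto simp: W_def p_def intro!: glue_colourings[OF l]\<close>)
      moreover have "card (W c) \<noteq> 0" using False fin by simp
      ultimately have "(\<Sum>\<sigma>\<in>W c. h \<sigma> * f (\<sigma> l)) = (\<Sum>\<sigma>\<in>W c. h \<sigma>) * g c"
        by (simp add: g_def field_simps)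
      also have "\<dots> = (\<Sum>\<sigma>\<in>W c. h \<sigma> * g (\<sigma> p))"
        unfolding sum_distrib_right by (intro sum.cong) (auto simp: W_def)
      finally show ?thesis .
    qed simp
    have "(\<Sum>\<sigma>\<in>\<Omega>. k \<sigma>) = (\<Sum>c\<in>(\<lambda>\<sigma>. \<sigma> p) ` \<Omega>. \<Sum>\<sigma>\<in>W c. k \<sigma>)" for k :: "('v \<Rightarrow> 'c) \<Rightarrow> real"
      unfolding W_def by (rule sum.image_gen) simp
    then show ?thesis unfolding p_def[symmetric] by (simp only: fibre)
  qed
  show mean: "(\<Sum>\<sigma>\<in>\<Omega>. g (\<sigma> (par l))) = 0"
    using *[of "\<lambda>_. 1"] f by simp
  have "(\<Sum>\<sigma>\<in>\<Omega>. g (\<sigma> p) * f (\<sigma> l)) = (\<Sum>\<sigma>\<in>\<Omega>. g (\<sigma> p) * g (\<sigma> (par l)))"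
    by (rule *) (simp add: D)
  then have gg: "(\<Sum>\<sigma>\<in>\<Omega>. g (\<sigma> (par l)) * f (\<sigma> l)) = (\<Sum>\<sigma>\<in>\<Omega>. (g (\<sigma> (par l)))\<^sup>2)"
    by (simp add: p_def power2_eq_square)
  \<comment> \<open>Scaling \<open>g\<close> by \<kappa> balances the two squares. Since the mixed
    moment of \<open>g\<close> and \<open>f\<close> is the second moment of \<open>g\<close>, the
    additive correlation bound becomes a contraction by 1 / \<kappa> in the L2 norm.\<close>
  have "2 * \<bar>\<Sum>\<sigma>\<in>\<Omega>. \<kappa> * g (\<sigma> (par l)) * f (\<sigma> l)\<bar>
    \<le> (1 / \<kappa>) * ((\<Sum>\<sigma>\<in>\<Omega>. (\<kappa> * g (\<sigma> (par l)))\<^sup>2) + (\<Sum>\<sigma>\<in>\<Omega>. (f (\<sigma> l))\<^sup>2))"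
    using mean by (intro edge_correlation[of l "\<lambda>c. \<kappa> * g c"] l f) (simp add: sum_distrib_left[symmetric])
  then have "2 * (\<kappa> * (\<Sum>\<sigma>\<in>\<Omega>. (g (\<sigma> (par l)))\<^sup>2))
    \<le> (1 / \<kappa>) * (\<kappa>\<^sup>2 * (\<Sum>\<sigma>\<in>\<Omega>. (g (\<sigma> (par l)))\<^sup>2) + (\<Sum>\<sigma>\<in>\<Omega>. (f (\<sigma> l))\<^sup>2))"
    using \<kappa> by (simp add: mult.assoc sum_distrib_left[symmetric] gg power_mult_distrib abs_mult sum_nonneg)
  then show "(\<Sum>\<sigma>\<in>\<Omega>. (g (\<sigma> (par l)))\<^sup>2) \<le> (1 / \<kappa>)\<^sup>2 * (\<Sum>\<sigma>\<in>\<Omega>. (f (\<sigma> l))\<^sup>2)"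
    using \<kappa> by (simp add: field_simps power2_eq_square)
qed

abbreviation weight :: "('v \<Rightarrow> 'c \<Rightarrow> real) \<Rightarrow> 'v \<Rightarrow> real" where
  "weight f v \<equiv> L2_set (\<lambda>\<sigma>. f v (\<sigma> v)) \<Omega>"

text \<open>
  Eliminating a leaf \<open>l\<close> replaces \<open>f l\<close> by its conditional expectation given the colour of
  the parent, which is absorbed into \<open>f (par l)\<close>; the second moment drops by at most
  \<open>(weight f l)\<^sup>2\<close>.
\<close>

lemma leaf_elimination:
  assumes "A \<subseteq> V" and "\<And>v. v \<in> A - {r} \<Longrightarrow> par v \<in> A"
    and "\<And>v. v \<in> A \<Longrightarrow> (\<Sum>\<sigma>\<in>\<Omega>. f v (\<sigma> v)) = 0"
  shows "\<exists>s. (\<forall>v\<in>A. 0 \<le> s v \<and>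
      s v \<le> weight f v + (1 / \<kappa>) * (\<Sum>w | w \<in> A - {r} \<and> par w = v. s w)) \<and>
    (\<Sum>\<sigma>\<in>\<Omega>. (\<Sum>v\<in>A. f v (\<sigma> v))\<^sup>2) \<le> (\<Sum>v\<in>A. (s v)\<^sup>2)"
  using assms
proof (induction "card A" arbitrary: A f rule: less_induct)
  case (less A f)
  have finA: "finite A" using less.prems(1) finite_V by (rule finite_subset)
  have sq: "(weight f v)\<^sup>2 = (\<Sum>\<sigma>\<in>\<Omega>. (f v (\<sigma> v))\<^sup>2)" for f :: "'v \<Rightarrow> 'c \<Rightarrow> real" and v
    by (simp add: L2_set_def sum_nonneg)
  show ?case
  proof (cases "A \<subseteq> {r}")
    case True
    then have "A = {} \<or> A = {r}" by auto
    then show ?thesis by (intro exI[of _ "weight f"]) (auto simp: sq sum_nonneg \<kappa>[THEN less_imp_le])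
  next
    case False
    have "depth ` (A - {r}) \<noteq> {}" "finite (depth ` (A - {r}))" using False finA by auto
    from Max_in[OF this(2,1)] Max_ge[OF this(2)]
    \<comment> \<open>A deepest vertex of \<open>A\<close> has no child in \<open>A\<close>.\<close>
    obtain l where l: "l \<in> A - {r}" and max: "\<And>w. w \<in> A - {r} \<Longrightarrow> depth w \<le> depth l"
      by (metis (no_types, lifting) imageE imageI)
    then have lV: "l \<in> V - {r}" using less.prems(1) by auto
    define p where "p = par l"
    have p: "p \<in> A" "p \<noteq> l" using less.prems(2)[OF l] depth[OF lV] by (auto simp: p_def)
    have leaf: "par w \<noteq> l" if "w \<in> A - {r}" for w
      using max[OF that] depth[of w] that less.prems(1) by fastforce
    define A' where "A' = A - {l}"
    have A': "A = insert l A'" "l \<notin> A'" "finite A'" "p \<in> A'" using l finA p by (auto simp: A'_def)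
    have closed: "par v \<in> A'" if "v \<in> A' - {r}" for v
      using less.prems(2)[of v] leaf[of v] that by (auto simp: A'_def)
    obtain g where g0: "(\<Sum>\<sigma>\<in>\<Omega>. g (\<sigma> p)) = 0"
      and g1: "(\<Sum>\<sigma>\<in>\<Omega>. (g (\<sigma> p))\<^sup>2) \<le> (1 / \<kappa>)\<^sup>2 * (\<Sum>\<sigma>\<in>\<Omega>. (f l (\<sigma> l))\<^sup>2)"
      and g2: "\<And>h. (\<And>\<sigma> \<tau>. h (override_on \<sigma> \<tau> (descendants l)) = h \<sigma>) \<Longrightarrow>
        (\<Sum>\<sigma>\<in>\<Omega>. h \<sigma> * f l (\<sigma> l)) = (\<Sum>\<sigma>\<in>\<Omega>. h \<sigma> * g (\<sigma> p))"
      using edge_projection[OF lV less.prems(3)[of l]] l unfolding p_def by blast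
    define f' where "f' = f(p := \<lambda>c. f p c + g c)"
    have "card A' < card A" using A' by simp
    moreover have "(\<Sum>\<sigma>\<in>\<Omega>. f' v (\<sigma> v)) = 0" if "v \<in> A'" for v
      using less.prems(3)[of v] that g0 by (auto simp: f'_def sum.distrib A')
    moreover have "A' \<subseteq> V" using less.prems(1) by (auto simp: A'_def)
    ultimately obtain s where s: "\<And>v. v \<in> A' \<Longrightarrow> 0 \<le> s v"
        "\<And>v. v \<in> A' \<Longrightarrow> s v \<le> weight f' v + (1 / \<kappa>) * (\<Sum>w | w \<in> A' - {r} \<and> par w = v. s w)"
        "(\<Sum>\<sigma>\<in>\<Omega>. (\<Sum>v\<in>A'. f' v (\<sigma> v))\<^sup>2) \<le> (\<Sum>v\<in>A'. (s v)\<^sup>2)"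
      using less.hyps[of A' f'] closed by blast
    define T where "T \<sigma> = (\<Sum>v\<in>A'. f v (\<sigma> v))" for \<sigma> :: "'v \<Rightarrow> 'c"
    have f'T: "(\<Sum>v\<in>A'. f' v (\<sigma> v)) = T \<sigma> + g (\<sigma> p)" for \<sigma>
    proof -
      have "(\<Sum>v\<in>A'. f' v (\<sigma> v)) = (\<Sum>v\<in>A'. f v (\<sigma> v) + (if v = p then g (\<sigma> p) else 0))"
        by (intro sum.cong) (auto simp: f'_def)
      then show ?thesis using A' by (simp add: T_def sum.distrib)
    qed
    have "(\<Sum>\<sigma>\<in>\<Omega>. T \<sigma> * f l (\<sigma> l)) = (\<Sum>\<sigma>\<in>\<Omega>. T \<sigma> * g (\<sigma> p))"
    proof (rule g2)
      fix \<sigma> \<tau> :: "'v \<Rightarrow> 'c"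
      have "v \<notin> descendants l" if "v \<in> A'" for v
        using descendants_disjoint[of A' l v] closed A' that by blast
      then show "T (override_on \<sigma> \<tau> (descendants l)) = T \<sigma>"
        by (simp add: T_def)
    qed
    \<comment> \<open>Pythagoras: the two squares have equal mixed terms, so passing from
      \<open>f l\<close> to \<open>g\<close> costs exactly the difference of the second moments of
      \<open>f l\<close> and \<open>g\<close>.\<close>
    then have "(\<Sum>\<sigma>\<in>\<Omega>. (T \<sigma> + f l (\<sigma> l))\<^sup>2) + (\<Sum>\<sigma>\<in>\<Omega>. (g (\<sigma> p))\<^sup>2)
        = (\<Sum>\<sigma>\<in>\<Omega>. (T \<sigma> + g (\<sigma> p))\<^sup>2) + (\<Sum>\<sigma>\<in>\<Omega>. (f l (\<sigma> l))\<^sup>2)"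
      by (simp add: power2_sum sum.distrib mult.assoc sum_distrib_left[symmetric])
    moreover have "(\<Sum>\<sigma>\<in>\<Omega>. (g (\<sigma> p))\<^sup>2) \<ge> 0" by (intro sum_nonneg) simp
    ultimately have drop: "(\<Sum>\<sigma>\<in>\<Omega>. (T \<sigma> + f l (\<sigma> l))\<^sup>2) \<le> (\<Sum>v\<in>A'. (s v)\<^sup>2) + (weight f l)\<^sup>2"
      using s(3) unfolding f'T sq by linarith
    have wp: "weight f' p \<le> weight f p + (1 / \<kappa>) * weight f l"
    proof -
      have "weight f' p \<le> weight f p + L2_set (\<lambda>\<sigma>. g (\<sigma> p)) \<Omega>"
        using L2_set_triangle_ineq[of "\<lambda>\<sigma>. f p (\<sigma> p)" "\<lambda>\<sigma>. g (\<sigma> p)" \<Omega>] by (simp add: f'_def)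
      also have "L2_set (\<lambda>\<sigma>. g (\<sigma> p)) \<Omega> \<le> (1 / \<kappa>) * weight f l"
        using real_sqrt_le_mono[OF g1] \<kappa> by (simp add: L2_set_def real_sqrt_mult real_sqrt_divide)
      finally show ?thesis by simp
    qed
    \<comment> \<open>The vertex \<open>l\<close> has no children in \<open>A\<close>, so its own
      weight is an admissible value there. In the recursion at the parent, this value accounts for
      the term by which \<open>wp\<close> exceeds the weight of \<open>f p\<close>.\<close>
    define s' where "s' = s(l := weight f l)"
    have ch: "(\<Sum>w | w \<in> A - {r} \<and> par w = v. s' w)
        = (\<Sum>w | w \<in> A' - {r} \<and> par w = v. s w) + (if v = p then weight f l else 0)" for v
    proof -
      have "{w. w \<in> A - {r} \<and> par w = v}
          = {w. w \<in> A' - {r} \<and> par w = v} \<union> (if v = p then {l} else {})"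
        using l by (auto simp: A' p_def)
      moreover have "(\<Sum>w | w \<in> A' - {r} \<and> par w = v. s' w) = (\<Sum>w | w \<in> A' - {r} \<and> par w = v. s w)"
        using A' by (intro sum.cong) (auto simp: s'_def)
      ultimately show ?thesis
        using A' by (auto simp: s'_def sum.insert_if)
    qed
    have "0 \<le> s' v \<and> s' v \<le> weight f v + (1 / \<kappa>) * (\<Sum>w | w \<in> A - {r} \<and> par w = v. s' w)"
      if v: "v \<in> A" for v
    proof (cases "v = l")
      case True
      have "(\<Sum>w | w \<in> A' - {r} \<and> par w = l. s w) = 0"
        using leaf by (intro sum.neutral) (auto simp: A')
      then show ?thesis using True p unfolding ch True by (simp add: s'_def)
    next
      case False
      then have v': "v \<in> A'" using v A' by auto
      have "weight f' v = weight f v" if "v \<noteq> p" using that by (simp add: f'_def)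
      then show ?thesis
        using s(1,2)[OF v'] wp False unfolding ch by (auto simp: s'_def distrib_left)
    qed
    moreover have "(\<Sum>\<sigma>\<in>\<Omega>. (\<Sum>v\<in>A. f v (\<sigma> v))\<^sup>2) \<le> (\<Sum>v\<in>A. (s' v)\<^sup>2)"
    proof -
      have "(\<Sum>v\<in>A'. (s' v)\<^sup>2) = (\<Sum>v\<in>A'. (s v)\<^sup>2)"
        using A' by (intro sum.cong) (auto simp: s'_def)
      then show ?thesis
        using drop A' by (simp add: s'_def T_def add.commute)
    qed
    ultimately show ?thesis by (intro exI[of _ s']) blast
  qed
qed

text \<open>Cauchy-Schwarz over at most \<open>b\<close> children costs a factor \<open>b\<close>;
  every vertex other than the root has one parent, so the squares regroup without
  repetition.\<close>

lemma children_norm_bound: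
  assumes b: "\<And>v. v \<in> V \<Longrightarrow> card {w \<in> V - {r}. par w = v} \<le> b"
  shows "L2_set (\<lambda>v. \<Sum>w | w \<in> V - {r} \<and> par w = v. s w) V \<le> sqrt b * L2_set s V"
proof -
  have CS: "(\<Sum>w | w \<in> V - {r} \<and> par w = v. s w)\<^sup>2
      \<le> real b * (\<Sum>w | w \<in> V - {r} \<and> par w = v. (s w)\<^sup>2)" if "v \<in> V" for v
  proof -
    have "(\<Sum>w | w \<in> V - {r} \<and> par w = v. 1 * s w)\<^sup>2 \<le>
      (\<Sum>w | w \<in> V - {r} \<and> par w = v. 1\<^sup>2) * (\<Sum>w | w \<in> V - {r} \<and> par w = v. (s w)\<^sup>2)"
      by (rule Cauchy_Schwarz_ineq_sum)
    also have "\<dots> \<le> real b * (\<Sum>w | w \<in> V - {r} \<and> par w = v. (s w)\<^sup>2)"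
      using b[OF that] by (intro mult_right_mono sum_nonneg) auto
    finally show ?thesis by simp
  qed
  have "(\<Sum>v\<in>V. (\<Sum>w | w \<in> V - {r} \<and> par w = v. s w)\<^sup>2)
      \<le> (\<Sum>v\<in>V. real b * (\<Sum>w | w \<in> V - {r} \<and> par w = v. (s w)\<^sup>2))"
    by (intro sum_mono CS)
  also have "\<dots> = real b * (\<Sum>w\<in>V - {r}. (s w)\<^sup>2)"
    unfolding sum_distrib_left[symmetric] using finite_V par by (subst sum.group) auto
  also have "\<dots> \<le> real b * (\<Sum>w\<in>V. (s w)\<^sup>2)"
    using finite_V by (intro mult_left_mono sum_mono2) auto
  finally show ?thesis
    unfolding L2_set_def real_sqrt_mult[symmetric] by (rule real_sqrt_le_mono)
qed

text \<open>Taking L2 norms over \<open>V\<close> in the recursion of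
  \<open>leaf_elimination\<close>, the sum over the children has norm at most
  \<open>sqrt b / \<kappa>\<close> times that of \<open>s\<close>. This is below 1 and can be
  absorbed on the left.\<close>

lemma second_moment_bound:
  assumes f: "\<And>v. v \<in> V \<Longrightarrow> (\<Sum>\<sigma>\<in>\<Omega>. f v (\<sigma> v)) = 0"
    and b: "\<And>v. v \<in> V \<Longrightarrow> card {w \<in> V - {r}. par w = v} \<le> b"
    and small: "sqrt b / \<kappa> < 1"
  shows "(\<Sum>\<sigma>\<in>\<Omega>. (\<Sum>v\<in>V. f v (\<sigma> v))\<^sup>2)
    \<le> (1 / (1 - sqrt b / \<kappa>))\<^sup>2 * (\<Sum>\<sigma>\<in>\<Omega>. \<Sum>v\<in>V. (f v (\<sigma> v))\<^sup>2)"
proof -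
  obtain s where s: "\<And>v. v \<in> V \<Longrightarrow> 0 \<le> s v"
      "\<And>v. v \<in> V \<Longrightarrow> s v \<le> weight f v + (1 / \<kappa>) * (\<Sum>w | w \<in> V - {r} \<and> par w = v. s w)"
      "(\<Sum>\<sigma>\<in>\<Omega>. (\<Sum>v\<in>V. f v (\<sigma> v))\<^sup>2) \<le> (\<Sum>v\<in>V. (s v)\<^sup>2)"
    using leaf_elimination[of V f] par f by blast
  have "L2_set s V \<le> L2_set (\<lambda>v. weight f v + (1 / \<kappa>) * (\<Sum>w | w \<in> V - {r} \<and> par w = v. s w)) V"
    using s by (intro L2_set_mono) auto
  also have "\<dots> \<le> L2_set (weight f) V
      + L2_set (\<lambda>v. (1 / \<kappa>) * (\<Sum>w | w \<in> V - {r} \<and> par w = v. s w)) V"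
    by (rule L2_set_triangle_ineq)
  also have "\<dots> = L2_set (weight f) V
      + (1 / \<kappa>) * L2_set (\<lambda>v. \<Sum>w | w \<in> V - {r} \<and> par w = v. s w) V"
    using \<kappa> by (subst L2_set_right_distrib) auto
  also have "\<dots> \<le> L2_set (weight f) V + (1 / \<kappa>) * (sqrt b * L2_set s V)"
    using \<kappa> by (intro add_left_mono mult_left_mono children_norm_bound b) auto
  finally have "(1 - sqrt b / \<kappa>) * L2_set s V \<le> L2_set (weight f) V"
    by (simp add: algebra_simps)
  then have "L2_set s V \<le> 1 / (1 - sqrt b / \<kappa>) * L2_set (weight f) V"
    using small by (simp add: field_simps)
  then have "(L2_set s V)\<^sup>2 \<le> (1 / (1 - sqrt b / \<kappa>))\<^sup>2 * (L2_set (weight f) V)\<^sup>2"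
    unfolding power_mult_distrib[symmetric] by (intro power_mono) auto
  also have "(L2_set (weight f) V)\<^sup>2 = (\<Sum>\<sigma>\<in>\<Omega>. \<Sum>v\<in>V. (f v (\<sigma> v))\<^sup>2)"
    by (subst sum.swap) (simp add: L2_set_def sum_nonneg)
  finally show ?thesis using s(3) by (simp add: L2_set_def sum_nonneg)
qed

end

section \<open>The second eigenvalue of a stochastic matrix\<close>

text \<open>The constant vector has eigenvalue 1. \<open>P\<close> is the change to the basis in
  which it replaces the first unit vector and \<open>Q\<close> is its inverse; there the matrix is
  block triangular, and the second block is the action modulo constants.\<close>

lemma char_poly_stochastic:
  fixes A :: "real mat"
  assumes A: "A \<in> carrier_mat (Suc n) (Suc n)"
    and rows: "\<And>i. i < Suc n \<Longrightarrow> (\<Sum>j<Suc n. A $$ (i, j)) = 1"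
  shows "char_poly A =
    [:- 1, 1:] * char_poly (mat n n (\<lambda>(i, j). A $$ (Suc i, Suc j) - A $$ (0, Suc j)))"
proof -
  let ?N = "Suc n"
  define P where "P = mat ?N ?N (\<lambda>(i, j). if i = j \<or> j = 0 then 1 else (0::real))"
  define Q where "Q = mat ?N ?N (\<lambda>(i, j). if i = j then 1 else if j = 0 then - 1 else (0::real))"
  define B where "B = mat ?N ?N (\<lambda>(i, j). if j = 0 then (if i = 0 then 1 else 0)
    else A $$ (i, j) - (if i = 0 then 0 else A $$ (0, j)))"
  define A2 where "A2 = mat 1 n (\<lambda>(i, j). A $$ (0, Suc j))"
  define A3 where "A3 = mat n n (\<lambda>(i, j). A $$ (Suc i, Suc j) - A $$ (0, Suc j))"
  have P: "P \<in> carrier_mat ?N ?N" and Q: "Q \<in> carrier_mat ?N ?N" and B: "B \<in> carrier_mat ?N ?N"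
    by (auto simp: P_def Q_def B_def)
  have sumP: "(\<Sum>k = 0..<?N. g k * (if k = j \<or> j = 0 then 1 else 0))
      = (if j = 0 then (\<Sum>k<?N. g k) else g j)" if "j < ?N" for j and g :: "nat \<Rightarrow> real"
    using that by (auto simp: atLeast0LessThan if_distrib[of "\<lambda>x. _ * x"] sum.delta simp del: sum.lessThan_Suc cong: if_cong)
  have sumQ: "(\<Sum>k = 0..<?N. (if i = k then 1 else if k = 0 then - 1 else 0) * g k)
      = (if i = 0 then g 0 else g i - g 0)" if "i < ?N" for i and g :: "nat \<Rightarrow> real"
  proof (cases "i = 0")
    case True
    then have "(\<Sum>k = 0..<?N. (if i = k then 1 else if k = 0 then - 1 else 0) * g k)
      = (\<Sum>k = 0..<?N. if k = 0 then g k else 0)"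
      by (intro sum.cong) auto
    then show ?thesis using True by (simp del: sum.op_ivl_Suc)
  next
    case False
    then have "(\<Sum>k = 0..<?N. (if i = k then 1 else if k = 0 then - 1 else 0) * g k)
      = (\<Sum>k = 0..<?N. (if k = i then g k else 0) - (if k = 0 then g k else 0))"
      by (intro sum.cong) auto
    then show ?thesis using False that by (simp add: sum_subtractf del: sum.op_ivl_Suc)
  qed
  have QP: "Q * P = 1\<^sub>m ?N"
    by (rule eq_matI) (simp_all add: P_def Q_def scalar_prod_def sumQ del: sum.op_ivl_Suc)
  have PQ: "P * Q = 1\<^sub>m ?N"
    by (rule mat_mult_left_right_inverse[OF Q P QP])
  have AP: "A * P = mat ?N ?N (\<lambda>(i, j). if j = 0 then 1 else A $$ (i, j))"
    using A rows by (intro eq_matI) (simp_all add: P_def scalar_prod_def sumP del: sum.op_ivl_Suc sum.lessThan_Suc)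
  have "Q * (A * P) = B"
    unfolding AP
    by (rule eq_matI) (simp_all add: Q_def B_def scalar_prod_def sumQ del: sum.op_ivl_Suc)
  then have "P * B * Q = P * (Q * (A * P)) * Q" by simp
  also have "\<dots> = (P * Q) * A * (P * Q)"
    using A P Q by (simp add: assoc_mult_mat[of _ ?N ?N _ ?N _ ?N])
  finally have "A = P * B * Q" using A PQ by simp
  then have "similar_mat_wit A B P Q"
    using A B P Q PQ QP by (simp add: similar_mat_wit_def Let_def)
  then have "char_poly A = char_poly B"
    by (intro char_poly_similar) (auto simp: similar_mat_def)
  also have "B = four_block_mat (1\<^sub>m 1) A2 (0\<^sub>m n 1) A3"
    by (rule eq_matI) (auto simp: B_def A2_def A3_def)
  also have "char_poly \<dots> = char_poly (1\<^sub>m 1) * char_poly A3"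
    by (rule char_poly_four_block_zeros_col) (auto simp: A2_def A3_def)
  also have "char_poly (1\<^sub>m 1) = [:- 1, 1:: real:]"
    by (simp add: char_poly_defs det_def sign_def)
  finally show ?thesis by (simp add: A3_def)
qed

text \<open>The index is that of the last entry but one. If \<open>a\<close> ends up last, this
  entry comes from \<open>zs\<close>; otherwise \<open>a\<close> is itself at most some element of
  \<open>zs\<close>.\<close>

lemma insort_nth_le:
  fixes zs :: "'a :: linorder list"
  assumes "zs \<noteq> []" "\<And>z. z \<in> set zs \<Longrightarrow> z \<le> \<theta>"
  shows "insort a zs ! (length zs - 1) \<le> \<theta>"
  using assms
proof (induction zs)
  case (Cons z zs)
  show ?case
  proof (cases "zs = []")
    case False
    then obtain m where "length zs = Suc m" by (cases zs) auto
    then show ?thesis using Cons.IH Cons.prems False nth_mem[of m "z # zs"] by (simp del: nth_mem)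
  qed (use Cons in auto)
qed simp

lemma second_largest_le:
  fixes M :: "'a :: linorder multiset"
  assumes "M \<noteq> {#}" "\<And>z. z \<in># M \<Longrightarrow> z \<le> \<theta>"
  shows "rev (sorted_list_of_multiset (add_mset a M)) ! 1 \<le> \<theta>"
proof -
  let ?zs = "sorted_list_of_multiset M"
  have len: "length ?zs = size M" "size M > 0"
    using assms(1) by (metis mset_sorted_list_of_multiset size_mset) (use assms(1) in \<open>simp add: nonempty_has_size\<close>)
  have "insort a ?zs ! (length ?zs - 1) \<le> \<theta>"
    using assms len by (intro insort_nth_le) auto
  then show ?thesis using len by (simp add: rev_nth)
qed

text \<open>
  Splitting off the eigenvalue 1 of the constant functions algebraically leaves a matrix all
  of whose real eigenvalues are controlled by the quadratic form on the functions of mean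
  zero; neither reversibility nor diagonalisability is needed. The eigenvalue \<open>\<mu>\<close>
  only guarantees that a second entry exists.
\<close>

lemma second_eigenvalue_le:
  fixes P :: "'x \<Rightarrow> 'x \<Rightarrow> real" and \<pi> h :: "'x \<Rightarrow> real"
  assumes S: "finite S"
    and rows: "\<And>x. x \<in> S \<Longrightarrow> (\<Sum>y\<in>S. P x y) = 1"
    and \<pi>: "\<And>x. x \<in> S \<Longrightarrow> \<pi> x > 0"
    and form: "\<And>f. (\<Sum>x\<in>S. \<pi> x * f x) = 0 \<Longrightarrow>
      (\<Sum>x\<in>S. \<pi> x * (f x * (\<Sum>y\<in>S. P x y * f y))) \<le> \<theta> * (\<Sum>x\<in>S. \<pi> x * (f x)\<^sup>2)"
    and \<mu>: "\<mu> \<noteq> 1" "x0 \<in> S" "h x0 \<noteq> 0" "\<And>x. x \<in> S \<Longrightarrow> (\<Sum>y\<in>S. P x y * h y) = \<mu> * h x"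
  shows "second_eigenvalue S P \<le> \<theta>"
proof -
  define xs where "xs = (SOME xs. set xs = S \<and> distinct xs)"
  have xs: "set xs = S" "distinct xs"
    using someI_ex[OF finite_distinct_list[OF S]] by (auto simp: xs_def)
  obtain n where n: "length xs = Suc n"
    using \<mu>(2) xs(1) by (cases xs) auto
  define A where "A = kernel_mat xs P"
  have A: "A \<in> carrier_mat (Suc n) (Suc n)" by (simp add: A_def kernel_mat_def n)
  have Aij: "A $$ (i, j) = P (xs ! i) (xs ! j)" if "i < Suc n" "j < Suc n" for i j
    using that by (simp add: A_def kernel_mat_def n)
  have sumS: "(\<Sum>x\<in>S. g x) = (\<Sum>i<Suc n. g (xs ! i))" for g :: "'x \<Rightarrow> real"
    using sum.reindex_bij_betw[OF bij_betw_nth[OF xs(2) refl xs(1)[symmetric]], of g] n by simp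
  have inS: "xs ! i \<in> S" if "i < Suc n" for i using that xs(1) n nth_mem by metis
  have index: "\<exists>i<Suc n. xs ! i = x" if "x \<in> S" for x
    using that n unfolding xs(1)[symmetric] in_set_conv_nth by simp
  define A3 where "A3 = mat n n (\<lambda>(i, j). A $$ (Suc i, Suc j) - A $$ (0, Suc j))"
  have A3: "A3 \<in> carrier_mat n n" by (simp add: A3_def)
  have cp: "char_poly A = [:- 1, 1:] * char_poly A3"
    unfolding A3_def
  proof (rule char_poly_stochastic[OF A])
    fix i assume i: "i < Suc n"
    have "(\<Sum>j<Suc n. A $$ (i, j)) = (\<Sum>y\<in>S. P (xs ! i) y)"
      unfolding sumS using i by (intro sum.cong) (auto simp: Aij)
    then show "(\<Sum>j<Suc n. A $$ (i, j)) = 1" using rows[OF inS[OF i]] by simp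
  qed
  have cp0: "char_poly A3 \<noteq> 0" using degree_monic_char_poly[OF A3] by auto
  have small: "e \<le> \<theta>" if root: "poly (char_poly A3) e = 0" for e
  proof -
    obtain v where v: "v \<in> carrier_vec n" "v \<noteq> 0\<^sub>v n" "A3 *\<^sub>v v = e \<cdot>\<^sub>v v"
      using root A3 unfolding eigenvalue_root_char_poly[OF A3, symmetric] eigenvalue_def eigenvector_def by auto
    \<comment> \<open>The eigenvector of the quotient matrix is lifted to a function on
      \<open>S\<close> that vanishes at the first state; the lift is an eigenfunction up to the
      additive constant \<open>c\<close>.\<close>
    define F where "F x = (case inv_into {..<Suc n} ((!) xs) x of 0 \<Rightarrow> 0 | Suc i \<Rightarrow> vec_index v i)" for x
    have inj: "inj_on ((!) xs) {..<Suc n}" using xs(2) n by (intro inj_on_nth) auto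
    have F: "F (xs ! i) = (case i of 0 \<Rightarrow> 0 | Suc i \<Rightarrow> vec_index v i)" if "i < Suc n" for i
      using that inv_into_f_f[OF inj, of i] by (simp add: F_def)
    define c where "c = (\<Sum>j<n. A $$ (0, Suc j) * vec_index v j)"
    have PF: "(\<Sum>y\<in>S. P x y * F y) = e * F x + c" if "x \<in> S" for x
    proof -
      obtain i where i: "i < Suc n" "x = xs ! i"
        using index[OF \<open>x \<in> S\<close>] by auto
      have "(\<Sum>y\<in>S. P x y * F y) = (\<Sum>j<Suc n. A $$ (i, j) * F (xs ! j))"
        unfolding sumS i(2) using i(1) by (intro sum.cong) (auto simp: Aij)
      also have "\<dots> = (\<Sum>j<n. A $$ (i, Suc j) * vec_index v j)"
        unfolding sum.lessThan_Suc_shift by (simp add: F)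
      finally have row: "(\<Sum>y\<in>S. P x y * F y) = (\<Sum>j<n. A $$ (i, Suc j) * vec_index v j)" .
      show ?thesis
      proof (cases i)
        case 0
        then show ?thesis using row i F[of 0] by (simp add: c_def)
      next
        case (Suc i')
        then have i': "i' < n" using i by simp
        have "vec_index (A3 *\<^sub>v v) i' = vec_index (e \<cdot>\<^sub>v v) i'" using v(3) by simp
        then have "(\<Sum>j<n. (A $$ (Suc i', Suc j) - A $$ (0, Suc j)) * vec_index v j) = e * vec_index v i'"
          using i' v(1) by (simp add: A3_def scalar_prod_def atLeast0LessThan)
        then show ?thesis
          using row Suc i F[of i] by (simp add: c_def left_diff_distrib sum_subtractf)
      qed
    qed
    \<comment> \<open>Centring makes \<open>f\<close> orthogonal to constants with respect to \<pi>,
      so the additive constant disappears from the quadratic form and only the factor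
      \<open>e\<close> remains.\<close>
    define m where "m = (\<Sum>x\<in>S. \<pi> x * F x) / sum \<pi> S"
    define f where "f x = F x - m" for x
    have "sum \<pi> S > 0" using S \<mu>(2) \<pi> by (intro sum_pos) auto
    moreover have "(\<Sum>x\<in>S. \<pi> x * f x) = (\<Sum>x\<in>S. \<pi> x * F x) - sum \<pi> S * m"
      by (simp add: f_def right_diff_distrib sum_subtractf sum_distrib_right)
    ultimately have f0: "(\<Sum>x\<in>S. \<pi> x * f x) = 0"
      by (simp add: m_def)
    have Pf: "(\<Sum>y\<in>S. P x y * f y) = e * f x + (e * m + c - m)" if "x \<in> S" for x
      using PF[OF that] rows[OF that]
      by (simp add: f_def right_diff_distrib sum_subtractf sum_distrib_right[symmetric])
    have "(\<Sum>x\<in>S. \<pi> x * (f x * (\<Sum>y\<in>S. P x y * f y)))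
        = (\<Sum>x\<in>S. e * (\<pi> x * (f x)\<^sup>2) + (e * m + c - m) * (\<pi> x * f x))"
    proof (rule sum.cong[OF refl])
      fix x assume x: "x \<in> S"
      show "\<pi> x * (f x * (\<Sum>y\<in>S. P x y * f y)) = e * (\<pi> x * (f x)\<^sup>2) + (e * m + c - m) * (\<pi> x * f x)"
        unfolding Pf[OF x] by (simp add: power2_eq_square algebra_simps)
    qed
    also have "\<dots> = e * (\<Sum>x\<in>S. \<pi> x * (f x)\<^sup>2)"
      using f0 by (simp add: sum.distrib sum_distrib_left[symmetric])
    finally have le: "e * (\<Sum>x\<in>S. \<pi> x * (f x)\<^sup>2) \<le> \<theta> * (\<Sum>x\<in>S. \<pi> x * (f x)\<^sup>2)"
      using form[OF f0] by simp
    \<comment> \<open>If \<open>f\<close> vanished, \<open>F\<close> would be constant, hence equal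
      to its value 0 at the first state, and \<open>v\<close> would be zero.\<close>
    have "\<exists>x\<in>S. f x \<noteq> 0"
    proof (rule ccontr)
      assume "\<not> ?thesis"
      then have Fm: "F (xs ! i) = m" if "i < Suc n" for i using inS[OF that] by (simp add: f_def)
      have "v = 0\<^sub>v n"
        using v(1) Fm[of 0] Fm[of "Suc _"] F[of 0] F[of "Suc _"] by (intro eq_vecI) auto
      then show False using v(2) by simp
    qed
    then obtain x where x: "x \<in> S" "f x \<noteq> 0" by auto
    have "(\<Sum>x\<in>S. \<pi> x * (f x)\<^sup>2) > 0"
      using \<pi> x by (intro sum_pos2[OF S x(1)]) (simp_all add: less_imp_le)
    then show ?thesis using le by simp
  qed
  define hv where "hv = vec (Suc n) (\<lambda>i. h (xs ! i))"
  have "eigenvector A hv \<mu>"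
  proof -
    obtain i where i: "i < Suc n" "xs ! i = x0" using index[OF \<mu>(2)] by auto
    then have "vec_index hv i \<noteq> 0" using \<mu>(3) by (simp add: hv_def)
    then have "hv \<noteq> 0\<^sub>v (Suc n)" using i by auto
    moreover have "A *\<^sub>v hv = \<mu> \<cdot>\<^sub>v hv"
    proof (rule eq_vecI)
      fix i assume "i < dim_vec (\<mu> \<cdot>\<^sub>v hv)"
      then have i: "i < Suc n" by (simp add: hv_def)
      have "vec_index (A *\<^sub>v hv) i = (\<Sum>j<Suc n. P (xs ! i) (xs ! j) * h (xs ! j))"
        using i A by (auto simp: hv_def scalar_prod_def atLeast0LessThan Aij intro!: sum.cong simp del: sum.lessThan_Suc sum.op_ivl_Suc)
      also have "\<dots> = \<mu> * h (xs ! i)"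
        using \<mu>(4)[OF inS[OF i]] unfolding sumS .
      finally show "vec_index (A *\<^sub>v hv) i = vec_index (\<mu> \<cdot>\<^sub>v hv) i" using i by (simp add: hv_def)
    qed (use A in \<open>simp add: hv_def\<close>)
    ultimately show ?thesis using A by (simp add: eigenvector_def hv_def)
  qed
  then have "poly (char_poly A) \<mu> = 0"
    using eigenvalue_root_char_poly[OF A] by (auto simp: eigenvalue_def)
  then have "\<mu> \<in># proots (char_poly A3)"
    using \<mu>(1) cp0 unfolding cp by simp
  moreover have "proots (char_poly A) = add_mset 1 (proots (char_poly A3))"
    unfolding cp using cp0 by (subst proots_mult) auto
  moreover have "rev (sorted_list_of_multiset (add_mset 1 (proots (char_poly A3)))) ! 1 \<le> \<theta>"
  proof (rule second_largest_le)
    show "proots (char_poly A3) \<noteq> {#}"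
      using \<open>\<mu> \<in># proots (char_poly A3)\<close> by (metis empty_iff set_mset_empty)
  qed (use small cp0 in auto)
  ultimately show ?thesis
    unfolding second_eigenvalue_def Let_def xs_def[symmetric] A_def[symmetric] by simp
qed

section \<open>The local walk\<close>

text \<open>\<open>N x\<close>, the number of colourings through the point \<open>x\<close>, serves
  as the stationary weight. It cancels the denominator of the walk and turns the quadratic form into
  the second moment of the sum minus the diagonal terms.\<close>

lemma second_eigenvalue_colour_walk:
  fixes \<Omega> :: "('v \<Rightarrow> 'c) set" and P :: "'v \<times> 'c \<Rightarrow> 'v \<times> 'c \<Rightarrow> real"
  assumes \<Omega>: "finite \<Omega>" "\<Omega> \<noteq> {}" and U: "finite U" "card U \<ge> 2"
    and S: "S = {(v, \<sigma> v) | v \<sigma>. v \<in> U \<and> \<sigma> \<in> \<Omega>}"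
    and P: "\<And>x y. x \<in> S \<Longrightarrow> y \<in> S \<Longrightarrow> P x y = (if x = y then 0
      else 1 / (real (card U) - 1) *
        (real (card {\<sigma> \<in> \<Omega>. \<sigma> (fst x) = snd x \<and> \<sigma> (fst y) = snd y})
          / real (card {\<sigma> \<in> \<Omega>. \<sigma> (fst x) = snd x})))"
    and var: "\<And>f. (\<Sum>\<sigma>\<in>\<Omega>. \<Sum>v\<in>U. f v (\<sigma> v)) = 0 \<Longrightarrow>
      (\<Sum>\<sigma>\<in>\<Omega>. (\<Sum>v\<in>U. f v (\<sigma> v))\<^sup>2) \<le> (1 + C) * (\<Sum>\<sigma>\<in>\<Omega>. \<Sum>v\<in>U. (f v (\<sigma> v))\<^sup>2)"
  shows "second_eigenvalue S P \<le> C / (real (card U) - 1)"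
proof -
  define k where "k = real (card U)"
  have k: "k - 1 > 0" using U(2) by (simp add: k_def)
  have "S = (\<lambda>(v, \<sigma>). (v, \<sigma> v)) ` (U \<times> \<Omega>)" using S by auto
  then have finS: "finite S" using U(1) \<Omega>(1) by simp
  define I :: "'v \<times> 'c \<Rightarrow> ('v \<Rightarrow> 'c) \<Rightarrow> real" where "I x \<sigma> = of_bool (\<sigma> (fst x) = snd x)" for x \<sigma>
  define N where "N x = (\<Sum>\<sigma>\<in>\<Omega>. I x \<sigma>)" for x
  have count: "(\<Sum>\<sigma>\<in>\<Omega>. of_bool (Q \<sigma>)) = real (card {\<sigma> \<in> \<Omega>. Q \<sigma>})" for Q
    using \<Omega>(1) by (simp add: sum.If_cases Int_def of_bool_def)
  have N: "N x = card {\<sigma> \<in> \<Omega>. \<sigma> (fst x) = snd x}" for x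
    by (simp only: N_def I_def count)
  have Npos: "N x > 0" if "x \<in> S" for x
    using that \<Omega>(1) S unfolding N by (auto simp: card_gt_0_iff)
  have sel: "(\<Sum>x\<in>S. I x \<sigma> * g x) = (\<Sum>v\<in>U. g (v, \<sigma> v))" if "\<sigma> \<in> \<Omega>" for \<sigma> and g :: "'v \<times> 'c \<Rightarrow> real"
  proof -
    have "(\<Sum>x\<in>S. I x \<sigma> * g x) = (\<Sum>x\<in>{x \<in> S. \<sigma> (fst x) = snd x}. g x)"
      using finS by (intro sum.mono_neutral_cong_right) (auto simp: I_def)
    also have "{x \<in> S. \<sigma> (fst x) = snd x} = (\<lambda>v. (v, \<sigma> v)) ` U"
      using that S by auto
    also have "(\<Sum>x\<in>\<dots>. g x) = (\<Sum>v\<in>U. g (v, \<sigma> v))"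
      by (subst sum.reindex) (auto simp: inj_on_def)
    finally show ?thesis .
  qed
  have walk: "(\<Sum>y\<in>S. P x y * g y)
      = (\<Sum>\<sigma>\<in>\<Omega>. I x \<sigma> * ((\<Sum>v\<in>U. g (v, \<sigma> v)) - g x)) / ((k - 1) * N x)"
    if x: "x \<in> S" for x g
  proof -
    \<comment> \<open>The subtracted term builds the zero diagonal into one formula valid for all
      \<open>y\<close>.\<close>
    have P': "P x y * g y = (\<Sum>\<sigma>\<in>\<Omega>. I x \<sigma> * (I y \<sigma> * (g y - (if y = x then g y else 0)))) / ((k - 1) * N x)"
      if "y \<in> S" for y
    proof -
      have "real (card {\<sigma> \<in> \<Omega>. \<sigma> (fst x) = snd x \<and> \<sigma> (fst y) = snd y}) = (\<Sum>\<sigma>\<in>\<Omega>. I x \<sigma> * I y \<sigma>)"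
        unfolding I_def of_bool_conj[symmetric] count ..
      then show ?thesis
        unfolding P[OF x that] N[symmetric] k_def[symmetric]
        by (simp add: sum_distrib_right mult.assoc)
    qed
    have "(\<Sum>y\<in>S. P x y * g y)
        = (\<Sum>y\<in>S. \<Sum>\<sigma>\<in>\<Omega>. I x \<sigma> * (I y \<sigma> * (g y - (if y = x then g y else 0)))) / ((k - 1) * N x)"
      by (simp add: P' sum_divide_distrib)
    also have "(\<Sum>y\<in>S. \<Sum>\<sigma>\<in>\<Omega>. I x \<sigma> * (I y \<sigma> * (g y - (if y = x then g y else 0))))
        = (\<Sum>\<sigma>\<in>\<Omega>. I x \<sigma> * (\<Sum>y\<in>S. I y \<sigma> * (g y - (if y = x then g y else 0))))"
      unfolding sum_distrib_left by (rule sum.swap)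
    also have "\<dots> = (\<Sum>\<sigma>\<in>\<Omega>. I x \<sigma> * ((\<Sum>v\<in>U. g (v, \<sigma> v)) - g x))"
    proof (rule sum.cong[OF refl])
      fix \<sigma> assume \<sigma>: "\<sigma> \<in> \<Omega>"
      have "(\<Sum>y\<in>S. I y \<sigma> * (g y - (if y = x then g y else 0)))
          = (\<Sum>y\<in>S. I y \<sigma> * g y) - (\<Sum>y\<in>S. if y = x then I y \<sigma> * g y else 0)"
        unfolding sum_subtractf[symmetric] by (intro sum.cong) (auto simp: right_diff_distrib)
      then have "(\<Sum>y\<in>S. I y \<sigma> * (g y - (if y = x then g y else 0)))
          = (\<Sum>v\<in>U. g (v, \<sigma> v)) - I x \<sigma> * g x"
        using sel[OF \<sigma>, of g] finS x by simp
      then show "I x \<sigma> * (\<Sum>y\<in>S. I y \<sigma> * (g y - (if y = x then g y else 0)))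
          = I x \<sigma> * ((\<Sum>v\<in>U. g (v, \<sigma> v)) - g x)"
        by (simp add: I_def)
    qed
    finally show ?thesis .
  qed
  have total: "(\<Sum>x\<in>S. N x * g x) = (\<Sum>\<sigma>\<in>\<Omega>. \<Sum>v\<in>U. g (v, \<sigma> v))" for g
    unfolding N_def sum_distrib_right by (subst sum.swap) (simp add: sel cong: sum.cong)
  obtain u v where uv: "u \<in> U" "v \<in> U" "u \<noteq> v"
    using U by (metis card_2_iff' ex_card subset_iff card_le_Suc0_iff_eq not_less_eq_eq numeral_2_eq_2)
  obtain \<sigma>0 where \<sigma>0: "\<sigma>0 \<in> \<Omega>" using \<Omega>(2) by auto
  \<comment> \<open>The difference of the indicators of two vertices sums to 0 over every colouring.
    Only the missing diagonal term remains, so it is an eigenfunction for -1 / (k - 1), which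
    supplies the second eigenvalue.\<close>
  define h :: "'v \<times> 'c \<Rightarrow> real" where "h x = of_bool (fst x = u) - of_bool (fst x = v)" for x
  have h0: "(\<Sum>w\<in>U. h (w, c w)) = 0" for c
    using U(1) uv by (simp add: h_def sum_subtractf of_bool_def)
  show ?thesis
  proof (rule second_eigenvalue_le[where \<pi> = N and \<mu> = "- 1 / (k - 1)" and h = h and ?x0.0 = "(u, \<sigma>0 u)"])
    show "finite S" by (rule finS)
    show "(\<Sum>y\<in>S. P x y) = 1" if "x \<in> S" for x
      using walk[OF that, of "\<lambda>_. 1"] k Npos[OF that]
      by (simp add: k_def[symmetric] sum_distrib_right[symmetric] N_def[symmetric])
    show "N x > 0" if "x \<in> S" for x using that by (rule Npos)
    show "(\<Sum>x\<in>S. N x * (f x * (\<Sum>y\<in>S. P x y * f y)))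
        \<le> C / (real (card U) - 1) * (\<Sum>x\<in>S. N x * (f x)\<^sup>2)"
      if f: "(\<Sum>x\<in>S. N x * f x) = 0" for f
    proof -
      define T where "T \<sigma> = (\<Sum>v\<in>U. f (v, \<sigma> v))" for \<sigma>
      define Q where "Q = (\<Sum>\<sigma>\<in>\<Omega>. \<Sum>v\<in>U. (f (v, \<sigma> v))\<^sup>2)"
      have "(\<Sum>x\<in>S. N x * (f x * (\<Sum>y\<in>S. P x y * f y)))
          = (\<Sum>x\<in>S. \<Sum>\<sigma>\<in>\<Omega>. I x \<sigma> * (f x * (T \<sigma> - f x))) / (k - 1)"
        unfolding sum_divide_distrib
      proof (rule sum.cong[OF refl])
        fix x assume x: "x \<in> S"
        have "N x * (f x * (\<Sum>y\<in>S. P x y * f y)) = f x * (\<Sum>\<sigma>\<in>\<Omega>. I x \<sigma> * (T \<sigma> - f x)) / (k - 1)"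
          unfolding walk[OF x] T_def[symmetric] using Npos[OF x] by simp
        then show "N x * (f x * (\<Sum>y\<in>S. P x y * f y))
            = (\<Sum>\<sigma>\<in>\<Omega>. I x \<sigma> * (f x * (T \<sigma> - f x)) / (k - 1))"
          by (simp add: sum_distrib_left sum_divide_distrib mult.left_commute)
      qed
      also have "(\<Sum>x\<in>S. \<Sum>\<sigma>\<in>\<Omega>. I x \<sigma> * (f x * (T \<sigma> - f x)))
          = (\<Sum>\<sigma>\<in>\<Omega>. \<Sum>v\<in>U. f (v, \<sigma> v) * (T \<sigma> - f (v, \<sigma> v)))"
        by (subst sum.swap) (intro sum.cong refl sel)
      also have "\<dots> = (\<Sum>\<sigma>\<in>\<Omega>. (T \<sigma>)\<^sup>2) - Q"
        unfolding Q_def sum_subtractf[symmetric]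
        by (intro sum.cong refl)
           (simp add: T_def right_diff_distrib sum_subtractf sum_distrib_right power2_eq_square)
      finally have lhs: "(\<Sum>x\<in>S. N x * (f x * (\<Sum>y\<in>S. P x y * f y))) = ((\<Sum>\<sigma>\<in>\<Omega>. (T \<sigma>)\<^sup>2) - Q) / (k - 1)" .
      have "(\<Sum>\<sigma>\<in>\<Omega>. (T \<sigma>)\<^sup>2) \<le> (1 + C) * Q"
        unfolding T_def Q_def using f total[of f] by (intro var[of "\<lambda>v c. f (v, c)"]) simp
      then have "(\<Sum>\<sigma>\<in>\<Omega>. (T \<sigma>)\<^sup>2) - Q \<le> C * Q" by (simp add: algebra_simps)
      then show ?thesis
        unfolding lhs total[of "\<lambda>x. (f x)\<^sup>2"] Q_def[symmetric] k_def[symmetric]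
        using k by (simp add: divide_right_mono)
    qed
    show "- 1 / (k - 1) \<noteq> 1" using k by (simp add: field_simps)
    show "(u, \<sigma>0 u) \<in> S" using S uv \<sigma>0 by auto
    show "h (u, \<sigma>0 u) \<noteq> 0" using uv by (simp add: h_def)
    show "(\<Sum>y\<in>S. P x y * h y) = - 1 / (k - 1) * h x" if "x \<in> S" for x
      using walk[OF that, of h] k Npos[OF that]
      by (simp add: h0 sum_distrib_right[symmetric] N_def[symmetric] sum_negf)
  qed
qed

section \<open>Centring, the single edge and the numerical constant\<close>

text \<open>The walk provides only a total mean of zero, the tree argument wants mean zero at each
  vertex. The means \<open>a v\<close> add up to 0, so subtracting them preserves the sum over
  \<open>U\<close> and does not increase the squares.\<close>

lemma second_moment_bound_centred:
  fixes \<Omega> :: "('v \<Rightarrow> 'c) set" and f :: "'v \<Rightarrow> 'c \<Rightarrow> real"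
  assumes \<Omega>: "finite \<Omega>" "\<Omega> \<noteq> {}" and K: "K \<ge> 0"
    and bound: "\<And>g. (\<And>v. v \<in> U \<Longrightarrow> (\<Sum>\<sigma>\<in>\<Omega>. g v (\<sigma> v)) = 0) \<Longrightarrow>
      (\<Sum>\<sigma>\<in>\<Omega>. (\<Sum>v\<in>U. g v (\<sigma> v))\<^sup>2) \<le> K * (\<Sum>\<sigma>\<in>\<Omega>. \<Sum>v\<in>U. (g v (\<sigma> v))\<^sup>2)"
    and f: "(\<Sum>\<sigma>\<in>\<Omega>. \<Sum>v\<in>U. f v (\<sigma> v)) = 0"
  shows "(\<Sum>\<sigma>\<in>\<Omega>. (\<Sum>v\<in>U. f v (\<sigma> v))\<^sup>2) \<le> K * (\<Sum>\<sigma>\<in>\<Omega>. \<Sum>v\<in>U. (f v (\<sigma> v))\<^sup>2)"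
proof -
  have m: "real (card \<Omega>) > 0" using \<Omega> by (simp add: card_gt_0_iff)
  define a where "a v = (\<Sum>\<sigma>\<in>\<Omega>. f v (\<sigma> v)) / card \<Omega>" for v
  have am: "(\<Sum>\<sigma>\<in>\<Omega>. f v (\<sigma> v)) = card \<Omega> * a v" for v using m by (simp add: a_def)
  have "card \<Omega> * (\<Sum>v\<in>U. a v) = 0"
    using f unfolding sum_distrib_left am[symmetric] by (subst sum.swap)
  then have a0: "(\<Sum>v\<in>U. a v) = 0" using m by simp
  have sq: "(\<Sum>\<sigma>\<in>\<Omega>. (f v (\<sigma> v) - a v)\<^sup>2) \<le> (\<Sum>\<sigma>\<in>\<Omega>. (f v (\<sigma> v))\<^sup>2)" for v
  proof -
    have "(\<Sum>\<sigma>\<in>\<Omega>. (f v (\<sigma> v) - a v)\<^sup>2)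
        = (\<Sum>\<sigma>\<in>\<Omega>. (f v (\<sigma> v))\<^sup>2) + card \<Omega> * (a v)\<^sup>2 - 2 * (\<Sum>\<sigma>\<in>\<Omega>. f v (\<sigma> v)) * a v"
      by (simp add: power2_diff sum.distrib sum_subtractf sum_distrib_left sum_distrib_right)
    also have "\<dots> = (\<Sum>\<sigma>\<in>\<Omega>. (f v (\<sigma> v))\<^sup>2) - card \<Omega> * (a v)\<^sup>2"
      unfolding am by (simp add: power2_eq_square)
    finally show ?thesis by simp
  qed
  have "(\<Sum>\<sigma>\<in>\<Omega>. (\<Sum>v\<in>U. f v (\<sigma> v))\<^sup>2) = (\<Sum>\<sigma>\<in>\<Omega>. (\<Sum>v\<in>U. f v (\<sigma> v) - a v)\<^sup>2)"
    using a0 by (simp add: sum_subtractf)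
  also have "\<dots> \<le> K * (\<Sum>\<sigma>\<in>\<Omega>. \<Sum>v\<in>U. (f v (\<sigma> v) - a v)\<^sup>2)"
    by (rule bound[of "\<lambda>v c. f v c - a v"]) (simp add: sum_subtractf am)
  also have "\<dots> \<le> K * (\<Sum>\<sigma>\<in>\<Omega>. \<Sum>v\<in>U. (f v (\<sigma> v))\<^sup>2)"
    using K by (subst (1 2) sum.swap) (intro mult_left_mono sum_mono sq)
  finally show ?thesis .
qed

text \<open>Covers \<Delta> = 1, where the root has \<Delta> children rather than \<Delta> - 1 and 1
  / \<kappa> = 1 / \<epsilon> may exceed 1. The square has a single mixed term, bounded by
  \<open>edge_correlation\<close>.\<close>

lemma (in coloured_tree) second_moment_bound_edge:
  assumes V: "V = {r, l}" "l \<noteq> r" and l: "par l = r"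
    and f: "\<And>v. v \<in> V \<Longrightarrow> (\<Sum>\<sigma>\<in>\<Omega>. f v (\<sigma> v)) = 0"
  shows "(\<Sum>\<sigma>\<in>\<Omega>. (\<Sum>v\<in>V. f v (\<sigma> v))\<^sup>2) \<le> (1 + 1 / \<kappa>) * (\<Sum>\<sigma>\<in>\<Omega>. \<Sum>v\<in>V. (f v (\<sigma> v))\<^sup>2)"
proof -
  have "2 * \<bar>\<Sum>\<sigma>\<in>\<Omega>. f r (\<sigma> r) * f l (\<sigma> l)\<bar>
      \<le> (1 / \<kappa>) * ((\<Sum>\<sigma>\<in>\<Omega>. (f r (\<sigma> r))\<^sup>2) + (\<Sum>\<sigma>\<in>\<Omega>. (f l (\<sigma> l))\<^sup>2))"
    using edge_correlation[of l "f r" "f l"] f[of r] f[of l] l V by auto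
  moreover have "\<And>g :: 'v \<Rightarrow> real. (\<Sum>v\<in>V. g v) = g r + g l" using V by auto
  ultimately show ?thesis
    by (simp add: power2_sum sum.distrib mult.assoc sum_distrib_left[symmetric] distrib_right)
qed

text \<open>The contraction factor \<open>t\<close> is bounded twice: the logarithmic assumption
  gives t \<le> 11/100, and \<open>sqrt (d - 1) \<le> d / 2\<close> gives 2 t \<le> 1 / \<epsilon>.
  It then suffices that (1 - t) to the power -2 is at most 21/20 + 2 t.\<close>

lemma contraction_constant_bound:
  fixes \<epsilon> :: real and \<Delta> :: nat
  assumes \<epsilon>: "\<epsilon> > 0" and \<Delta>: "\<Delta> \<ge> 2" and ln: "(ln (real \<Delta>))\<^sup>2 / real \<Delta> \<le> \<epsilon>\<^sup>2 / 100"
  shows "sqrt (real (\<Delta> - 1)) / (\<epsilon> * real \<Delta>) < 1"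
    and "(1 / (1 - sqrt (real (\<Delta> - 1)) / (\<epsilon> * real \<Delta>)))\<^sup>2 \<le> 1 + (1 / 20 + 1 / \<epsilon>)"
proof -
  define d where "d = real \<Delta>"
  have d: "d \<ge> 2" using \<Delta> by (simp add: d_def)
  have d1: "real (\<Delta> - 1) = d - 1" using \<Delta> by (simp add: d_def)
  define t where "t = sqrt (d - 1) / (\<epsilon> * d)"
  have t0: "t \<ge> 0" using d \<epsilon> by (simp add: t_def)
  have t2: "t\<^sup>2 = (d - 1) / (\<epsilon>\<^sup>2 * d\<^sup>2)" using d by (simp add: t_def power_divide power_mult_distrib)
  have "100 * (ln d)\<^sup>2 \<le> \<epsilon>\<^sup>2 * d" using ln d by (simp add: d_def field_simps)
  \<comment> \<open>The constant 121/100 leads to the square of 11/100 below. The tight case is d =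
    2, where 1/2 is compared with 121/100 times 4/9; from d = 3 on, the logarithm is at least
    1.\<close>
  moreover have "(d - 1) / d \<le> 121 / 100 * (ln d)\<^sup>2"
  proof (cases "\<Delta> = 2")
    case True
    have "(2 / 3)\<^sup>2 \<le> (ln (2::real))\<^sup>2" using ln2_ge_two_thirds by (intro power_mono) auto
    then show ?thesis using True by (simp add: d_def power2_eq_square)
  next
    case False
    then have "d \<ge> 3" using \<Delta> by (simp add: d_def)
    then have "exp 1 \<le> d" using exp_le by linarith
    then have "1 \<le> ln d" using d by (simp add: ln_ge_iff)
    then have "1 \<le> (ln d)\<^sup>2" by (simp add: one_le_power)
    moreover have "(d - 1) / d \<le> 1" using d by simp
    ultimately show ?thesis by linarith
  qed
  ultimately have "(d - 1) / d \<le> 121 / 10000 * (\<epsilon>\<^sup>2 * d)" by linarith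
  then have "t\<^sup>2 \<le> 121 / 10000" unfolding t2 using d \<epsilon> by (simp add: field_simps power2_eq_square)
  then have "t\<^sup>2 \<le> (11 / 100)\<^sup>2" by (simp add: power2_eq_square)
  then have t1: "t \<le> 11 / 100" by (rule power2_le_imp_le) simp
  have "sqrt (d - 1) \<le> d / 2"
  proof (rule real_le_lsqrt)
    show "d - 1 \<le> (d / 2)\<^sup>2" using zero_le_power2[of "d - 2"] by (simp add: power2_eq_square field_simps)
  qed (use d in auto)
  then have "sqrt (d - 1) / (\<epsilon> * d) \<le> (d / 2) / (\<epsilon> * d)" using d \<epsilon> by (intro divide_right_mono) auto
  then have t3: "2 * t \<le> 1 / \<epsilon>" using d \<epsilon> by (simp add: t_def)
  show "sqrt (real (\<Delta> - 1)) / (\<epsilon> * real \<Delta>) < 1"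
    using t1 unfolding t_def d1 d_def[symmetric] by linarith
  \<comment> \<open>The losses t/10 \<le> 0.011 and 59/20 times the square of t, below 0.036, fit
    into the slack 1/20.\<close>
  have "1 \<le> (21 / 20 + 2 * t) * (1 - t)\<^sup>2"
  proof -
    have "(21 / 20 + 2 * t) * (1 - t)\<^sup>2 = 21 / 20 - t / 10 - 59 / 20 * t\<^sup>2 + 2 * t * t\<^sup>2"
      by (simp add: power2_eq_square field_simps)
    moreover have "t * t\<^sup>2 \<ge> 0" using t0 by simp
    ultimately show ?thesis using t1 \<open>t\<^sup>2 \<le> 121 / 10000\<close> by linarith
  qed
  then have "(1 / (1 - t))\<^sup>2 \<le> 21 / 20 + 2 * t"
    using t1 by (simp add: power_divide divide_le_eq)
  then show "(1 / (1 - sqrt (real (\<Delta> - 1)) / (\<epsilon> * real \<Delta>)))\<^sup>2 \<le> 1 + (1 / 20 + 1 / \<epsilon>)"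
    using t3 unfolding t_def[symmetric] d1 d_def[symmetric] by linarith
qed

lemma cond_prob_pmf_of_set:
  assumes "finite A" "A \<noteq> {}"
  shows "\<P>(\<sigma> in measure_pmf (pmf_of_set A). Q \<sigma> \<bar> R \<sigma>)
    = real (card {\<sigma> \<in> A. Q \<sigma> \<and> R \<sigma>}) / real (card {\<sigma> \<in> A. R \<sigma>})"
proof -
  have "A \<inter> {\<sigma>. B \<sigma>} = {\<sigma> \<in> A. B \<sigma>}" for B by auto
  then show ?thesis
    using assms by (simp add: cond_prob_def measure_pmf_of_set card_gt_0_iff)
qed

theorem theorem4p6:
  fixes G :: "'v pair_pre_digraph" and L :: "'v \<Rightarrow> nat set"
    and \<epsilon> :: real and \<Delta> q n k :: nat and \<tau> :: "('v \<times> nat) set"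
  assumes "\<epsilon> > 0"
    and "list_coloring_instance q G L"
    and "tree_graph G"
    and "n = card (pverts G)"
    and "\<Delta> = max_vdegree G"
    and "extra_color (\<epsilon> * real \<Delta>) G L"
    and "(ln (real \<Delta>))\<^sup>2 / real \<Delta> \<le> \<epsilon>\<^sup>2 / 100"
    and "2 \<le> k" and "k \<le> n"
    and "\<tau> \<in> coloring_complex G L"
    and "codim G \<tau> = k"
  shows "second_eigenvalue (link_points (coloring_complex G L) \<tau>) (local_walk G L \<tau>)
           \<le> (1 / 20 + 1 / \<epsilon>) / (real k - 1)"
proof -
  define V where "V = pverts G"
  interpret pair_graph G using assms(3) by (simp add: tree_graph_def)
  have finV: "finite V" by (simp add: V_def pair_finite_verts)
  obtain r par depth where r: "r \<in> V" and T: "rooted_on G r par depth V" and deg_r: "vdegree G r = 1"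
  proof -
    have "card (pverts G) \<ge> 2" using assms(4,8,9) by simp
    from tree_graph_leaf_rooted[OF assms(3) this] that show thesis unfolding V_def by blast
  qed
  have deg: "vdegree G v = card {w \<in> V - {r}. par w = v} + of_bool (v \<noteq> r)" if "v \<in> V" for v
    using rooted_on_vdegree[OF pair_graph_axioms] T that unfolding V_def by blast
  have deg_le: "vdegree G v \<le> \<Delta>" if "v \<in> V" for v
    using that finV unfolding assms(5) max_vdegree_def V_def by (intro Max_ge) auto
  have \<Delta>1: "\<Delta> \<ge> 1" using deg_le[OF r] deg_r by simp
  have par_props: "par v \<in> V" "depth (par v) < depth v" if "v \<in> V - {r}" for v
    using T that unfolding rooted_on_def by blast+
  have edge: "(u, v) \<in> parcs G \<longleftrightarrow> u \<noteq> r \<and> v = par u \<or> v \<noteq> r \<and> u = par v"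
    if "u \<in> V" "v \<in> V" for u v
    using T that unfolding rooted_on_def by blast
  have finL: "finite (L v)" if "v \<in> V" for v
    using assms(2) that unfolding list_coloring_instance_def V_def by (auto intro: finite_subset)

  \<comment> \<open>Facets containing the face as colourings with pinned vertices\<close>
  define gr :: "('v \<Rightarrow> nat) \<Rightarrow> ('v \<times> nat) set" where "gr \<sigma> = (\<lambda>v. (v, \<sigma> v)) ` V" for \<sigma>
  have facets: "facets G L = gr ` {\<sigma>. proper_coloring G L \<sigma>}"
    by (auto simp: facets_def gr_def V_def)
  obtain \<sigma>0 where \<sigma>0: "proper_coloring G L \<sigma>0" "\<tau> \<subseteq> gr \<sigma>0"
    using assms(10) unfolding coloring_complex_def facets by auto
  \<comment> \<open>The face is the graph of \<sigma>0 on \<open>D\<close>: the vertices of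
    \<open>D\<close> are pinned, and the remaining \<open>U\<close> has exactly \<open>k\<close>
    elements.\<close>
  define D where "D = fst ` \<tau>"
  define U where "U = V - D"
  have D: "D \<subseteq> V" and \<tau>: "\<tau> = (\<lambda>v. (v, \<sigma>0 v)) ` D"
    using \<sigma>0(2) by (force simp: D_def gr_def image_iff)+
  have "card \<tau> = card D" unfolding \<tau> by (intro card_image) (auto simp: inj_on_def)
  then have kU: "card U = k"
    using assms(11) D finV finite_subset[OF D finV] by (simp add: U_def card_Diff_subset codim_def V_def)
  have UV: "U \<subseteq> V" and finU: "finite U" using finV by (auto simp: U_def)

  interpret coloured_tree V r par depth L U \<sigma>0 "\<epsilon> * real \<Delta>"
  proof
    show "\<epsilon> * real \<Delta> + real (card {w \<in> V - {r}. par w = v} + of_bool (v \<noteq> r)) \<le> real (card (L v))"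
      if "v \<in> U" for v
    proof -
      have "v \<in> V" using that UV by auto
      then have "\<epsilon> * real \<Delta> + real (vdegree G v) \<le> real (card (L v))"
        using assms(6) by (simp add: extra_color_def V_def)
      then show ?thesis unfolding deg[OF \<open>v \<in> V\<close>] .
    qed
  qed (use finV r par_props finL UV assms(1) \<Delta>1 in auto)

  have proper_iff: "proper_coloring G L \<sigma> \<longleftrightarrow> (\<forall>v\<in>V. \<sigma> v \<in> L v) \<and> (\<forall>v\<in>V - {r}. \<sigma> v \<noteq> \<sigma> (par v))" for \<sigma>
  proof -
    have "(\<forall>(u, v)\<in>parcs G. \<sigma> u \<noteq> \<sigma> v) \<longleftrightarrow> (\<forall>v\<in>V - {r}. \<sigma> v \<noteq> \<sigma> (par v))"
    proof (intro iffI ballI)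
      fix v assume "\<forall>(u, v)\<in>parcs G. \<sigma> u \<noteq> \<sigma> v" and v: "v \<in> V - {r}"
      moreover have "(v, par v) \<in> parcs G" using edge[of v "par v"] par[OF v] v by auto
      ultimately show "\<sigma> v \<noteq> \<sigma> (par v)" by auto
    next
      fix e assume *: "\<forall>v\<in>V - {r}. \<sigma> v \<noteq> \<sigma> (par v)" and e: "e \<in> parcs G"
      obtain u v where uv: "e = (u, v)" by (cases e)
      then have "u \<in> V" "v \<in> V" using e in_arcsD1 in_arcsD2 by (auto simp: V_def)
      then have "u \<noteq> r \<and> v = par u \<or> v \<noteq> r \<and> u = par v" using edge[of u v] e uv by auto
      then show "case e of (u, v) \<Rightarrow> \<sigma> u \<noteq> \<sigma> v"
        using * \<open>u \<in> V\<close> \<open>v \<in> V\<close> uv by (metis DiffI case_prod_conv singletonD)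
    qed
    then show ?thesis by (simp add: proper_coloring_def V_def)
  qed
  have \<Omega>_iff: "\<sigma> \<in> \<Omega> \<longleftrightarrow> \<sigma> \<in> extensional V \<and> proper_coloring G L \<sigma> \<and> (\<forall>v\<in>D. \<sigma> v = \<sigma>0 v)" for \<sigma>
  proof -
    have "V - U = D" using D by (auto simp: U_def)
    then show ?thesis using D by (auto simp: colourings_def proper_iff PiE_iff)
  qed
  have gr_mem: "x \<in> gr \<sigma> \<longleftrightarrow> fst x \<in> V \<and> \<sigma> (fst x) = snd x" for x \<sigma>
    by (cases x) (auto simp: gr_def)
  have \<tau>_sub: "\<tau> \<subseteq> gr \<sigma> \<longleftrightarrow> (\<forall>v\<in>D. \<sigma> v = \<sigma>0 v)" for \<sigma>
    unfolding \<tau> using D by (auto simp: gr_mem)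
  have gr_restrict: "gr (restrict \<sigma> V) = gr \<sigma>" for \<sigma> by (auto simp: gr_def)
  have proper_restrict: "proper_coloring G L (restrict \<sigma> V) \<longleftrightarrow> proper_coloring G L \<sigma>" for \<sigma>
    unfolding proper_iff using par by auto
  \<comment> \<open>Proper colourings are arbitrary outside \<open>V\<close>, so many of them give
    the same facet; restriction to \<open>V\<close> selects the representative in \<Omega>.\<close>
  have gr_\<Omega>: "{F \<in> facets G L. \<tau> \<subseteq> F} = gr ` \<Omega>"
  proof (intro equalityI subsetI)
    fix F assume "F \<in> {F \<in> facets G L. \<tau> \<subseteq> F}"
    then obtain \<sigma> where "F = gr \<sigma>" "proper_coloring G L \<sigma>" "\<tau> \<subseteq> gr \<sigma>" by (auto simp: facets)
    then show "F \<in> gr ` \<Omega>"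
      using D proper_restrict[of \<sigma>] by (intro image_eqI[of _ _ "restrict \<sigma> V"]) (auto simp: gr_restrict \<tau>_sub \<Omega>_iff)
  next
    fix F assume "F \<in> gr ` \<Omega>"
    then obtain \<sigma> where \<sigma>: "F = gr \<sigma>" "\<sigma> \<in> \<Omega>" by auto
    then have "\<tau> \<subseteq> gr \<sigma>" unfolding \<tau>_sub \<Omega>_iff by blast
    then show "F \<in> {F \<in> facets G L. \<tau> \<subseteq> F}" using \<sigma> by (auto simp: facets \<Omega>_iff)
  qed
  have inj_gr: "inj_on gr \<Omega>"
  proof (rule inj_onI)
    fix \<sigma> \<sigma>' assume \<sigma>: "\<sigma> \<in> \<Omega>" "\<sigma>' \<in> \<Omega>" and eq: "gr \<sigma> = gr \<sigma>'"
    have "\<sigma> v = \<sigma>' v" if "v \<in> V" for v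
      using gr_mem[of "(v, \<sigma> v)" \<sigma>] gr_mem[of "(v, \<sigma> v)" \<sigma>'] eq that by simp
    then show "\<sigma> = \<sigma>'" using \<sigma> by (auto simp: \<Omega>_iff intro: extensionalityI)
  qed
  have \<Omega>0: "restrict \<sigma>0 V \<in> \<Omega>" using \<sigma>0(1) D by (auto simp: \<Omega>_iff proper_restrict)
  have fin\<Omega>: "finite \<Omega>" by simp

  \<comment> \<open>The link and the transition probabilities\<close>
  define S where "S = link_points (coloring_complex G L) \<tau>"
  have S: "S = {(v, \<sigma> v) | v \<sigma>. v \<in> U \<and> \<sigma> \<in> \<Omega>}"
  proof (intro equalityI subsetI)
    fix x assume "x \<in> S"
    then have x: "x \<notin> \<tau>" and "\<exists>F\<in>facets G L. \<tau> \<union> {x} \<subseteq> F"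
      by (auto simp: S_def link_points_def coloring_complex_def)
    then have "\<exists>F\<in>{F \<in> facets G L. \<tau> \<subseteq> F}. x \<in> F" by auto
    then obtain \<sigma> where \<sigma>: "\<sigma> \<in> \<Omega>" "x \<in> gr \<sigma>" unfolding gr_\<Omega> by auto
    moreover have "fst x \<notin> D" using x \<sigma> by (cases x) (auto simp: \<tau> gr_mem \<Omega>_iff)
    ultimately show "x \<in> {(v, \<sigma> v) | v \<sigma>. v \<in> U \<and> \<sigma> \<in> \<Omega>}"
      by (cases x) (auto simp: gr_mem U_def)
  next
    fix x assume "x \<in> {(v, \<sigma> v) | v \<sigma>. v \<in> U \<and> \<sigma> \<in> \<Omega>}"
    then obtain v \<sigma> where x: "x = (v, \<sigma> v)" "v \<in> U" "\<sigma> \<in> \<Omega>" by auto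
    then have "gr \<sigma> \<in> {F \<in> facets G L. \<tau> \<subseteq> F}" unfolding gr_\<Omega> by auto
    moreover have "x \<in> gr \<sigma>" "x \<notin> \<tau>" using x by (auto simp: gr_mem U_def \<tau>)
    ultimately show "x \<in> S" by (auto simp: S_def link_points_def coloring_complex_def)
  qed

  have "facets G L \<subseteq> gr ` (Pi\<^sub>E V L)"
  proof
    fix F assume "F \<in> facets G L"
    then obtain \<sigma> where "F = gr \<sigma>" "proper_coloring G L \<sigma>" by (auto simp: facets)
    then show "F \<in> gr ` (Pi\<^sub>E V L)"
      by (intro image_eqI[of _ _ "restrict \<sigma> V"]) (auto simp: gr_restrict proper_iff)
  qed
  then have fin_facets: "finite (facets G L)"
    using finite_PiE[OF finV finL] by (auto intro: finite_subset)
  have ne_facets: "facets G L \<noteq> {}" using \<sigma>0(1) by (auto simp: facets)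
  \<comment> \<open>Used with one point for the denominator and with two points for the numerator of
    the conditional probability.\<close>
  have count: "card {F \<in> facets G L. (\<forall>x\<in>X. x \<in> F) \<and> \<tau> \<subseteq> F} = card {\<sigma> \<in> \<Omega>. \<forall>x\<in>X. \<sigma> (fst x) = snd x}"
    if "X \<subseteq> S" for X
  proof -
    have XV: "fst x \<in> V" if "x \<in> X" for x 
    proof -
      have "x \<in> S" using \<open>X \<subseteq> S\<close> that by auto
      then show ?thesis using UV unfolding S by auto
    qed
    have "{F \<in> facets G L. (\<forall>x\<in>X. x \<in> F) \<and> \<tau> \<subseteq> F} = {F \<in> {F \<in> facets G L. \<tau> \<subseteq> F}. \<forall>x\<in>X. x \<in> F}" by auto
    also have "\<dots> = gr ` {\<sigma> \<in> \<Omega>. \<forall>x\<in>X. \<sigma> (fst x) = snd x}"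
      unfolding gr_\<Omega> using XV by (auto simp: gr_mem)
    finally show ?thesis using inj_gr by (simp add: card_image inj_on_subset[of gr \<Omega>])
  qed

  have walk: "local_walk G L \<tau> x y = (if x = y then 0 else 1 / (real (card U) - 1) *
      (real (card {\<sigma> \<in> \<Omega>. \<sigma> (fst x) = snd x \<and> \<sigma> (fst y) = snd y})
        / real (card {\<sigma> \<in> \<Omega>. \<sigma> (fst x) = snd x})))" if "x \<in> S" "y \<in> S" for x y
  proof -
    have "{F \<in> facets G L. y \<in> F \<and> \<tau> \<union> {x} \<subseteq> F} = {F \<in> facets G L. (\<forall>z\<in>{x, y}. z \<in> F) \<and> \<tau> \<subseteq> F}"
      "{F \<in> facets G L. \<tau> \<union> {x} \<subseteq> F} = {F \<in> facets G L. (\<forall>z\<in>{x}. z \<in> F) \<and> \<tau> \<subseteq> F}" by auto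
    then show ?thesis
      using count[of "{x, y}"] count[of "{x}"] that
      unfolding local_walk_def facet_distr_def cond_prob_pmf_of_set[OF fin_facets ne_facets] assms(11) kU
      by simp
  qed

  \<comment> \<open>The variance bound on the whole tree and on the free vertices\<close>
  have var_V: "(\<Sum>\<sigma>\<in>\<Omega>. (\<Sum>v\<in>V. f v (\<sigma> v))\<^sup>2)
      \<le> (1 + (1 / 20 + 1 / \<epsilon>)) * (\<Sum>\<sigma>\<in>\<Omega>. \<Sum>v\<in>V. (f v (\<sigma> v))\<^sup>2)"
    if f: "\<And>v. v \<in> V \<Longrightarrow> (\<Sum>\<sigma>\<in>\<Omega>. f v (\<sigma> v)) = 0" for f
  proof -
    have nonneg: "(\<Sum>\<sigma>\<in>\<Omega>. \<Sum>v\<in>V. (f v (\<sigma> v))\<^sup>2) \<ge> 0" by (intro sum_nonneg) auto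
    show ?thesis
    proof (cases "\<Delta> = 1")
      case True
      \<comment> \<open>Any other parent would have both a child and a parent of its own, hence
        degree at least 2.\<close>
      have "par v = r" if "v \<in> V - {r}" for v
      proof (rule ccontr)
        assume "par v \<noteq> r"
        moreover have "finite {w \<in> V - {r}. par w = par v}" using finV by simp
        then have "card {w \<in> V - {r}. par w = par v} > 0" using that by (auto simp: card_gt_0_iff)
        ultimately show False
          using deg[of "par v"] deg_le[of "par v"] par[OF that] True by simp
      qed
      then have "{w \<in> V - {r}. par w = r} = V - {r}" by auto
      then have "card (V - {r}) = 1" using deg[OF r] deg_r by simp
      then obtain l where "V - {r} = {l}" by (auto simp: card_1_singleton_iff)
      then have l: "V = {r, l}" "l \<noteq> r" "par l = r" using r \<open>{w \<in> V - {r}. par w = r} = V - {r}\<close> by auto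
      have "(\<Sum>\<sigma>\<in>\<Omega>. (\<Sum>v\<in>V. f v (\<sigma> v))\<^sup>2) \<le> (1 + 1 / \<epsilon>) * (\<Sum>\<sigma>\<in>\<Omega>. \<Sum>v\<in>V. (f v (\<sigma> v))\<^sup>2)"
        using second_moment_bound_edge[OF l f] True by simp
      also have "\<dots> \<le> (1 + (1 / 20 + 1 / \<epsilon>)) * (\<Sum>\<sigma>\<in>\<Omega>. \<Sum>v\<in>V. (f v (\<sigma> v))\<^sup>2)"
        using nonneg by (intro mult_right_mono) auto
      finally show ?thesis .
    next
      case False
      then have \<Delta>2: "\<Delta> \<ge> 2" using \<Delta>1 by simp
      note num = contraction_constant_bound[OF assms(1) \<Delta>2 assms(7)]
      \<comment> \<open>A vertex other than the root spends one neighbour on its parent; the root is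
        a leaf, and its single child is allowed since \<Delta> is at least 2.\<close>
      have "card {w \<in> V - {r}. par w = v} \<le> \<Delta> - 1" if "v \<in> V" for v
        using deg[OF that] deg_le[OF that] deg_r \<Delta>2 by (cases "v = r") auto
      from second_moment_bound[OF f this num(1)]
      show ?thesis using mult_right_mono[OF num(2) nonneg] by (rule order_trans)
    qed
  qed
  have var_U: "(\<Sum>\<sigma>\<in>\<Omega>. (\<Sum>v\<in>U. g v (\<sigma> v))\<^sup>2)
      \<le> (1 + (1 / 20 + 1 / \<epsilon>)) * (\<Sum>\<sigma>\<in>\<Omega>. \<Sum>v\<in>U. (g v (\<sigma> v))\<^sup>2)"
    if g: "\<And>v. v \<in> U \<Longrightarrow> (\<Sum>\<sigma>\<in>\<Omega>. g v (\<sigma> v)) = 0" for g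
  proof -
    \<comment> \<open>Extension by zero to the pinned vertices changes neither side.\<close>
    define f where "f v c = (if v \<in> U then g v c else 0)" for v c
    have sums: "(\<Sum>v\<in>V. f v (\<sigma> v)) = (\<Sum>v\<in>U. g v (\<sigma> v))"
      "(\<Sum>v\<in>V. (f v (\<sigma> v))\<^sup>2) = (\<Sum>v\<in>U. (g v (\<sigma> v))\<^sup>2)" for \<sigma>
      using finV UV by (auto simp: f_def intro!: sum.mono_neutral_cong_right)
    have "(\<Sum>\<sigma>\<in>\<Omega>. f v (\<sigma> v)) = 0" for v
      using g[of v] by (cases "v \<in> U") (simp_all add: f_def)
    then show ?thesis using var_V[of f] unfolding sums by simp
  qed
  have "second_eigenvalue S (local_walk G L \<tau>) \<le> (1 / 20 + 1 / \<epsilon>) / (real (card U) - 1)"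
  proof (rule second_eigenvalue_colour_walk[OF fin\<Omega> _ finU _ S walk])
    show "\<Omega> \<noteq> {}" using \<Omega>0 by auto
    show "card U \<ge> 2" using kU assms(8) by simp
    show "(\<Sum>\<sigma>\<in>\<Omega>. (\<Sum>v\<in>U. f v (\<sigma> v))\<^sup>2)
        \<le> (1 + (1 / 20 + 1 / \<epsilon>)) * (\<Sum>\<sigma>\<in>\<Omega>. \<Sum>v\<in>U. (f v (\<sigma> v))\<^sup>2)"
      if "(\<Sum>\<sigma>\<in>\<Omega>. \<Sum>v\<in>U. f v (\<sigma> v)) = 0" for f
    proof (rule second_moment_bound_centred[OF fin\<Omega>])
      show "\<Omega> \<noteq> {}" using \<Omega>0 by auto
    qed (use assms(1) var_U that in auto)
  qed
  then show ?thesis by (simp add: S_def kU)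
qed

end
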